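(* Let $F=K(x,y)/K(x)$ be the Kummer extension defined by $y^m=f(x)=\alpha\prod_{i=1}^r p_i(x)^{\lambda_i}$ described in the context. Suppose that $d_s=\gcd(m,\lambda_s)=1$ for some $0\leq s\leq r$, and let $\lambda\in\mathbb{Z}$ be an inverse of $\lambda_s$ modulo $m$. Then $$H(Q_s)=\left\langle m,\ m\left(\sum_{k=0}^r\left\lceil\frac{i\lambda\lambda_k}{m}\right\rceil d_k-1\right)+i \;:\; 1\leq i\leq m-1\right\rangle,$$ where $\langle\cdot\rangle$ denotes the additive submonoid of $\mathbb{N}_0$ generated by the listed elements.
   Context: Setting. Let $q$ be a prime power, $K$ an algebraic extension of $\mathbb{F}_q$, $m\geq 2$ an integer with $\gcd(m,q)=1$, and $r\geq 2$. Let $F=K(x,y)$ with $y^m=f(x)=\alpha\prod_{i=1}^r p_i(x)^{\lambda_i}$, where $\alpha\in K\setminus\{0\}$, $\lambda_i\in\mathbb{Z}\setminus\{0\}$, the $p_i(x)\in K[x]$ are pairwise distinct monic irreducible polynomials, and for every $d\mid m$ with $d\geq 2$, $f(x)$ is not a $d$-th power of an element of $K(x)$. ($K$ is not required to contain a primitive $m$-th root of unity; $K$ is the full constant field of $F$.) Put $d_i=\deg p_i$ for $1\leq i\leq r$, $d_0=1$, and $\lambda_0=-\sum_{i=1}^r\lambda_i d_i$. Let $P_i$ ($1\leq i\leq r$) be the place of $K(x)$ that is the zero of $p_i(x)$, and $P_0$ the pole of $x$. If $\gcd(m,\lambda_i)=1$, then $P_i$ is totally ramified in $F$ and $Q_i$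 denotes the unique place of $F$ over $P_i$; it has degree $d_i$. For a rational (degree one) place $P$ of $F$, the Weierstrass semigroup is $H(P)=\{n\in\mathbb{N}_0 : \exists z\in F,\ (z)_\infty=nP\}$, where $(z)_\infty$ is the pole divisor. *)

theory Defs
  imports
    "HOL-Computational_Algebra.Computational_Algebra"
    "HOL-Number_Theory.Cong"
    "HOL-Number_Theory.Prime_Powers"
begin

section \<open>Subfields of a field\<close>

definition is_subfield :: "'a::field set \<Rightarrow> bool" where
  "is_subfield S \<longleftrightarrow> 0 \<in> S \<and> 1 \<in> S \<and>
     (\<forall>a\<in>S. \<forall>b\<in>S. a + b \<in> S \<and> a * b \<in> S) \<and> (\<forall>a\<in>S. - a \<in> S \<and> inverse a \<in> S)"

definition generated_field :: "'a::field set \<Rightarrow> 'a set" where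
  "generated_field A = \<Inter>{S. is_subfield S \<and> A \<subseteq> S}"

definition algebraic_over :: "'a::field set \<Rightarrow> 'a \<Rightarrow> bool" where
  "algebraic_over S z \<longleftrightarrow> (\<exists>p. p \<noteq> 0 \<and> (\<forall>i. coeff p i \<in> S) \<and> poly p z = 0)"


section \<open>Places, valuations and pole divisors\<close>

text \<open>
  Function fields \<open>F/K\<close> are modelled by a field type \<open>F\<close> with the set \<open>K\<close> of its constants.
  A place is the maximal ideal (the set of non-units) of a valuation ring.
\<close>

definition valuation_ring :: "'a::field set \<Rightarrow> 'a set \<Rightarrow> bool" where
  "valuation_ring K R \<longleftrightarrow> K \<subset> R \<and> R \<noteq> UNIV \<and>
     (\<forall>a\<in>R. \<forall>b\<in>R. a + b \<in> R \<and> a - b \<in> R \<and> a * b \<in> R) \<and>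
     (\<forall>z. z \<in> R \<or> inverse z \<in> R)"

definition ring_units :: "'a::field set \<Rightarrow> 'a set" where
  "ring_units R = {u\<in>R. \<exists>w\<in>R. u * w = 1}"

definition is_place :: "'a::field set \<Rightarrow> 'a set \<Rightarrow> bool" where
  "is_place K P \<longleftrightarrow> (\<exists>R. valuation_ring K R \<and> P = R - ring_units R)"

text \<open>
  The valuation ring of a place is recovered as the set of all \<open>z\<close> with \<open>z\<^sup>-\<^sup>1 \<notin> P\<close>; zero is
  listed separately since \<open>inverse 0 = 0 \<in> P\<close>.
\<close>

definition place_ring :: "'a::field set \<Rightarrow> 'a set" where
  "place_ring P = {z. z = 0 \<or> inverse z \<notin> P}"

text \<open>
  The normalized discrete valuation of a place: \<open>z = t\<^sup>n u\<close> with \<open>t\<close> a prime element (a generator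
  of \<open>P\<close>) and \<open>u\<close> a unit. The value is meaningful for \<open>z \<noteq> 0\<close> only.
\<close>

definition place_val :: "'a::field set \<Rightarrow> 'a \<Rightarrow> int" where
  "place_val P z = (THE n. \<exists>t u. P = {t * w | w. w \<in> place_ring P} \<and>
     u \<in> ring_units (place_ring P) \<and> z = t powi n * u)"

text \<open>Divisors are represented as integer-valued functions that vanish outside the places.\<close>

definition pole_divisor :: "'a::field set \<Rightarrow> 'a \<Rightarrow> 'a set \<Rightarrow> int" where
  "pole_divisor K z = (\<lambda>P. if is_place K P \<and> place_val P z < 0 then - place_val P z else 0)"

definition weierstrass_semigroup :: "'a::field set \<Rightarrow> 'a set \<Rightarrow> nat set" where
  "weierstrass_semigroup K Q =
     {n. \<exists>z. z \<noteq> 0 \<and> pole_divisor K z = (\<lambda>P. if P = Q then int n else 0)}"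

inductive_set submonoid_generated :: "'a::comm_monoid_add set \<Rightarrow> 'a set" for A where
  zero: "0 \<in> submonoid_generated A"
| incl: "a \<in> A \<Longrightarrow> a \<in> submonoid_generated A"
| add: "a \<in> submonoid_generated A \<Longrightarrow> b \<in> submonoid_generated A \<Longrightarrow> a + b \<in> submonoid_generated A"


section \<open>The rational function field\<close>

text \<open>\<open>K(x)\<close> is the type \<open>'k poly fract\<close>; this is the embedding of \<open>K\<close> into it.\<close>

definition const_fract :: "'k::field \<Rightarrow> 'k poly fract" where
  "const_fract c = to_fract [:c:]"

definition zero_place :: "'k::field poly \<Rightarrow> 'k poly fract set" where
  "zero_place p = {Fract g h | g h. p dvd g \<and> \<not> p dvd h}"

definition infinite_place :: "'k::field poly fract set" where
  "infinite_place = {Fract g h | g h. h \<noteq> 0 \<and> (g = 0 \<or> degree g < degree h)}"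


section \<open>Kummer extensions\<close>

definition kummer_rhs :: "nat \<Rightarrow> 'k::field \<Rightarrow> (nat \<Rightarrow> 'k poly) \<Rightarrow> (nat \<Rightarrow> int) \<Rightarrow> 'k poly fract" where
  "kummer_rhs r \<alpha> p l = const_fract \<alpha> * (\<Prod>i=1..r. to_fract (p i) powi l i)"

text \<open>
  The data \<open>d\<^sub>i\<close>, \<open>\<lambda>\<^sub>i\<close>, \<open>P\<^sub>i\<close>, where the index 0 stands for the pole of \<open>x\<close>. The values of
  \<open>p\<close> and \<open>l\<close> at 0 are irrelevant.
\<close>

definition kummer_deg :: "(nat \<Rightarrow> 'k::field poly) \<Rightarrow> nat \<Rightarrow> nat" where
  "kummer_deg p i = (if i = 0 then 1 else degree (p i))"

definition kummer_exp :: "nat \<Rightarrow> (nat \<Rightarrow> 'k::field poly) \<Rightarrow> (nat \<Rightarrow> int) \<Rightarrow> nat \<Rightarrow> int" where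
  "kummer_exp r p l i = (if i = 0 then - (\<Sum>j=1..r. l j * int (degree (p j))) else l i)"

definition kummer_base_place :: "(nat \<Rightarrow> 'k::field poly) \<Rightarrow> nat \<Rightarrow> 'k poly fract set" where
  "kummer_base_place p i = (if i = 0 then infinite_place else zero_place (p i))"

text \<open>
  The field \<open>F = K(x,y)\<close> is the whole type \<open>'f\<close>; it contains \<open>K(x)\<close> by means of the field
  homomorphism \<open>\<iota>\<close>.
\<close>

locale kummer_extension =
  fixes q m r :: nat
    and \<alpha> :: "'k::field" and p :: "nat \<Rightarrow> 'k poly" and l :: "nat \<Rightarrow> int"
    and \<iota> :: "'k poly fract \<Rightarrow> 'f::field" and y :: 'f
  assumes q_primepow: "primepow q"
    and K_algebraic: "\<exists>k. is_subfield k \<and> card k = q \<and> (\<forall>a::'k. algebraic_over k a)"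
    and m_ge_2: "m \<ge> 2"
    and coprime_m_q: "coprime m q"
    and r_ge_2: "r \<ge> 2"
    and alpha_nonzero: "\<alpha> \<noteq> 0"
    and exponents_nonzero: "\<And>i. i \<in> {1..r} \<Longrightarrow> l i \<noteq> 0"
    and monic: "\<And>i. i \<in> {1..r} \<Longrightarrow> lead_coeff (p i) = 1"
    and irreducible: "\<And>i. i \<in> {1..r} \<Longrightarrow> irreducible (p i)"
    and distinct: "inj_on p {1..r}"
    and not_power: "\<And>d. d dvd m \<Longrightarrow> d \<ge> 2 \<Longrightarrow> \<not> (\<exists>g. kummer_rhs r \<alpha> p l = g ^ d)"
    and hom_one: "\<iota> 1 = 1"
    and hom_add: "\<And>a b. \<iota> (a + b) = \<iota> a + \<iota> b"
    and hom_mult: "\<And>a b. \<iota> (a * b) = \<iota> a * \<iota> b"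
    and equation: "y ^ m = \<iota> (kummer_rhs r \<alpha> p l)"
    and generated: "generated_field (insert y (range \<iota>)) = UNIV"
    and full_constant_field:
      "\<And>z. algebraic_over (range (\<iota> \<circ> const_fract)) z \<Longrightarrow> z \<in> range (\<iota> \<circ> const_fract)"

end

theory Submission
  imports Defs
begin

text \<open>
  Put \<open>\<eta> = y\<^sup>-\<^sup>\<mu>\<close>, so that \<open>\<eta>\<^sup>m = g\<close> lies in \<open>K(x)\<close>, the valuation of \<open>g\<close> at \<open>P\<^sub>k\<close> is
  \<open>- \<mu> \<lambda>\<^sub>k\<close>, and this is \<open>-1\<close> modulo \<open>m\<close> for \<open>k = s\<close>. Every element of \<open>F\<close> is a sum of
  \<open>h\<^sub>i \<eta>\<^sup>i\<close> with \<open>0 \<le> i < m\<close>, and the values of these terms at \<open>Q\<^sub>s\<close> are distinct modulo \<open>m\<close>.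
  If the sum has no pole outside \<open>Q\<^sub>s\<close>, then it is integral over the valuation ring of every place of
  \<open>K(x)\<close> other than \<open>P\<^sub>s\<close>, and raising it to high powers of the characteristic shows that each single
  term is integral there, too. So the pole numbers are those of the terms \<open>h \<eta>\<^sup>i\<close>; for fixed \<open>i\<close>
  the integrality conditions are lower bounds for the valuations of \<open>h\<close> at all places other than
  \<open>P\<^sub>s\<close>, and since a principal divisor has degree zero, the least pole number is the one in the list.
\<close>

section \<open>Discrete valuations\<close>

text \<open>The statement involves all places of F, and \<open>place_val\<close> is a definite
  description that is meaningful only at discrete places. So nothing about the places of F is
  presupposed: each is shown to lie over a place of K(x) and to be discrete, and conversely
  valuation rings are constructed so that regularity at all places over a given one amounts to
  integrality. Without a primitive m-th root of unity there are no automorphisms multiplying \<eta>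
  by roots of unity to average over; the Frobenius argument replaces them and works because the
  characteristic is prime to m. The exponent -\<mu> is chosen for the congruence at s: h \<eta>^i
  then has pole order congruent to i modulo m there, so the index of a term is the index of a
  generator. Total ramification is not quoted: comparing values at Q_s yields e = m, the uniqueness
  of the place and the linear independence of the powers of \<eta>.\<close>

text \<open>The value at \<open>0\<close> is unspecified.\<close>

locale discrete_valuation =
  fixes v :: "'a::field \<Rightarrow> int"
  assumes val_mult: "a \<noteq> 0 \<Longrightarrow> b \<noteq> 0 \<Longrightarrow> v (a * b) = v a + v b"
    and val_add: "a \<noteq> 0 \<Longrightarrow> b \<noteq> 0 \<Longrightarrow> a + b \<noteq> 0 \<Longrightarrow> min (v a) (v b) \<le> v (a + b)"
    and val_uniformizer: "\<exists>t. t \<noteq> 0 \<and> v t = 1"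
begin

lemma val_one [simp]: "v 1 = 0"
  using val_mult[of 1 1] by simp

lemma val_inverse: "a \<noteq> 0 \<Longrightarrow> v (inverse a) = - v a"
  using val_mult[of a "inverse a"] by simp

lemma val_divide: "a \<noteq> 0 \<Longrightarrow> b \<noteq> 0 \<Longrightarrow> v (a / b) = v a - v b"
  by (simp add: divide_inverse val_mult val_inverse)

lemma val_power: "a \<noteq> 0 \<Longrightarrow> v (a ^ n) = int n * v a"
  by (induction n) (simp_all add: val_mult algebra_simps)

lemma val_power_int: "a \<noteq> 0 \<Longrightarrow> v (a powi n) = n * v a"
  by (simp add: power_int_def val_power val_inverse power_inverse)

lemma val_prod: "(\<And>i. i \<in> A \<Longrightarrow> f i \<noteq> 0) \<Longrightarrow> v (\<Prod>i\<in>A. f i) = (\<Sum>i\<in>A. v (f i))"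
  by (induction A rule: infinite_finite_induct) (simp_all add: val_mult)

lemma val_minus: "a \<noteq> 0 \<Longrightarrow> v (- a) = v a"
proof -
  assume a: "a \<noteq> 0"
  have "v (-1) + v (-1) = 0" using val_mult[of "-1" "-1"] by simp
  then show ?thesis using val_mult[of "-1" a] a by simp
qed

lemma val_add_less:
  assumes "a \<noteq> 0" "b = 0 \<or> v a < v b"
  shows "a + b \<noteq> 0" "v (a + b) = v a"
proof -
  have *: "a + b \<noteq> 0 \<and> v (a + b) = v a" if b: "b \<noteq> 0"
  proof -
    from b assms have less: "v a < v b" by simp
    have ne: "a + b \<noteq> 0"
      using less val_minus[OF b] by (metis add_eq_0_iff2 less_irrefl)
    have "min (v a) (v b) \<le> v (a + b)" using val_add[of a b] assms b ne by simp
    moreover have "min (v (a + b)) (v (- b)) \<le> v a"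
      using val_add[of "a + b" "- b"] ne b assms by simp
    ultimately show ?thesis using less ne val_minus[OF b] by (auto simp: min_def split: if_splits)
  qed
  show "a + b \<noteq> 0" "v (a + b) = v a" using * assms by (cases "b = 0"; simp)+
qed

lemma val_sum_ge:
  assumes "\<And>i. i \<in> A \<Longrightarrow> f i = 0 \<or> c \<le> v (f i)"
  shows "sum f A = 0 \<or> c \<le> v (sum f A)"
  using assms
proof (induction A rule: infinite_finite_induct)
  case (insert i A)
  then have "f i = 0 \<or> c \<le> v (f i)" "sum f A = 0 \<or> c \<le> v (sum f A)" by auto
  then show ?case using insert.hyps val_add[of "f i" "sum f A"]
    by (cases "f i = 0 \<or> sum f A = 0 \<or> f i + sum f A = 0") auto
qed simp_all

text \<open>At each addition the strictly smaller value wins. The dominating index is recorded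
  because the term itself, not only its value, is analysed later.\<close>

lemma val_sum_distinct:
  assumes "finite A" "A \<noteq> {}" "\<And>i. i \<in> A \<Longrightarrow> f i \<noteq> 0" "inj_on (\<lambda>i. v (f i)) A"
  shows "sum f A \<noteq> 0 \<and> (\<exists>i\<in>A. v (sum f A) = v (f i) \<and> (\<forall>j\<in>A. v (f i) \<le> v (f j)))"
  using assms
proof (induction A rule: finite_ne_induct)
  case (insert i A)
  then obtain k where k: "k \<in> A" "v (sum f A) = v (f k)" "\<forall>j\<in>A. v (f k) \<le> v (f j)"
    and ne: "sum f A \<noteq> 0" by auto
  have dist: "v (f i) \<noteq> v (f k)" using insert k by (auto simp: inj_on_def)
  have fi: "f i \<noteq> 0" using insert by simp
  show ?case
  proof (cases "v (f i) < v (f k)")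
    case True
    then have "f i + sum f A \<noteq> 0" "v (f i + sum f A) = v (f i)"
      using val_add_less[of "f i" "sum f A"] fi k by simp_all
    then show ?thesis using True k insert.hyps by fastforce
  next
    case False
    then have "sum f A + f i \<noteq> 0" "v (sum f A + f i) = v (sum f A)"
      using val_add_less[of "sum f A" "f i"] ne k dist by simp_all
    then show ?thesis using False k insert.hyps by (auto simp: add.commute)
  qed
qed auto

definition val_ring :: "'a set" where
  "val_ring = {a. a = 0 \<or> 0 \<le> v a}"

lemma val_ring_closed:
  assumes "a \<in> val_ring" "b \<in> val_ring"
  shows "a + b \<in> val_ring" "- a \<in> val_ring" "a * b \<in> val_ring"
proof -
  show "a + b \<in> val_ring"
    using assms val_add[of a b] by (cases "a = 0 \<or> b = 0 \<or> a + b = 0") (auto simp: val_ring_def)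
  show "- a \<in> val_ring" using assms val_minus[of a] by (cases "a = 0") (auto simp: val_ring_def)
  show "a * b \<in> val_ring" using assms val_mult[of a b]
    by (cases "a = 0 \<or> b = 0") (auto simp: val_ring_def)
qed

lemma one_in_val_ring [simp]: "1 \<in> val_ring"
  by (simp add: val_ring_def)

end


section \<open>Valuation rings and places\<close>

lemma valuation_ringD:
  assumes "valuation_ring K R"
  shows "K \<subseteq> R" "R \<noteq> UNIV" "a \<in> R \<Longrightarrow> b \<in> R \<Longrightarrow> a + b \<in> R"
    "a \<in> R \<Longrightarrow> b \<in> R \<Longrightarrow> a - b \<in> R" "a \<in> R \<Longrightarrow> b \<in> R \<Longrightarrow> a * b \<in> R"
    "a \<in> R \<or> inverse a \<in> R"
  using assms unfolding valuation_ring_def by blast+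

lemma valuation_ring_one: "valuation_ring K R \<Longrightarrow> 1 \<in> R"
  using valuation_ringD(6)[of K R 1] by simp

lemma valuation_ring_zero: "valuation_ring K R \<Longrightarrow> 0 \<in> R"
  using valuation_ringD(6)[of K R 0] by simp

lemma valuation_ring_minus: "valuation_ring K R \<Longrightarrow> a \<in> R \<Longrightarrow> - a \<in> R"
  using valuation_ringD(4)[of K R 0 a] valuation_ring_zero[of K R] by simp

lemma valuation_ring_power: "valuation_ring K R \<Longrightarrow> a \<in> R \<Longrightarrow> a ^ n \<in> R"
  by (induction n) (auto intro: valuation_ringD valuation_ring_one)

lemma valuation_ring_sum:
  "valuation_ring K R \<Longrightarrow> (\<And>i. i \<in> A \<Longrightarrow> f i \<in> R) \<Longrightarrow> sum f A \<in> R"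
  by (induction A rule: infinite_finite_induct)
    (auto intro: valuation_ringD valuation_ring_zero)

lemma ring_units_iff: "u \<in> ring_units R \<longleftrightarrow> u \<in> R \<and> u \<noteq> 0 \<and> inverse u \<in> R"
proof
  assume "u \<in> ring_units R"
  then obtain w where "u \<in> R" "w \<in> R" "u * w = 1" by (auto simp: ring_units_def)
  then show "u \<in> R \<and> u \<noteq> 0 \<and> inverse u \<in> R"
    by (metis inverse_unique mult_zero_left zero_neq_one)
qed (auto simp: ring_units_def intro!: bexI[of _ "inverse u"])

lemma in_place_iff:
  assumes "valuation_ring K R"
  shows "z \<in> R - ring_units R \<longleftrightarrow> z = 0 \<or> inverse z \<notin> R"
  using valuation_ringD(6)[OF assms, of z] valuation_ring_zero[OF assms]
  by (auto simp: ring_units_iff)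

lemma place_ring_eq:
  assumes "valuation_ring K R"
  shows "place_ring (R - ring_units R) = R"
proof (rule set_eqI)
  fix z
  have "z \<in> place_ring (R - ring_units R) \<longleftrightarrow> z = 0 \<or> \<not> (inverse z = 0 \<or> z \<notin> R)"
    unfolding place_ring_def mem_Collect_eq in_place_iff[OF assms] by simp
  then show "z \<in> place_ring (R - ring_units R) \<longleftrightarrow> z \<in> R"
    using valuation_ring_zero[OF assms] by auto
qed

text \<open>A case of integral closedness: if z is outside R, then its inverse is inside, and z =
  z^n (z^-1)^(n-1). It allows passing from z^m, which may lie in K(x), to z.\<close>

lemma valuation_ring_power_iff:
  assumes "valuation_ring K R" "n > 0"
  shows "z ^ n \<in> R \<longleftrightarrow> z \<in> R"
proof
  assume zn: "z ^ n \<in> R"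
  show "z \<in> R"
  proof (rule ccontr)
    assume "z \<notin> R"
    have i: "inverse z \<in> R" using valuation_ringD(6)[OF assms(1), of z] \<open>z \<notin> R\<close> by blast
    have z: "z \<noteq> 0" using valuation_ring_zero[OF assms(1)] \<open>z \<notin> R\<close> by blast
    have "z ^ n * inverse z ^ (n - 1) \<in> R"
      using valuation_ringD(5)[OF assms(1) zn] valuation_ring_power[OF assms(1) i] by blast
    moreover have "z ^ n * inverse z ^ (n - 1) = z"
      using z assms(2) by (cases n) (simp_all add: power_inverse)
    ultimately show False using \<open>z \<notin> R\<close> by simp
  qed
qed (use assms in \<open>auto intro: valuation_ring_power\<close>)

text \<open>One of x / y and y / x lies in R. If x / y does, then 1 / y = (x - y)^-1 (x / y - 1), so
  an inverse of x - y in R would put the inverse of y into R; the other case is symmetric.\<close>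

lemma nonunit_diff:
  assumes R: "valuation_ring K R"
    and "x = 0 \<or> inverse x \<notin> R" "y = 0 \<or> inverse y \<notin> R"
  shows "x - y = 0 \<or> inverse (x - y) \<notin> R"
proof (rule ccontr)
  assume "\<not> (x - y = 0 \<or> inverse (x - y) \<notin> R)"
  then have d: "x - y \<noteq> 0" "inverse (x - y) \<in> R" by auto
  then have d': "inverse (y - x) \<in> R"
    using valuation_ring_minus[OF R d(2)] by (metis inverse_minus_eq minus_diff_eq)
  show False
  proof (cases "x = 0 \<or> y = 0")
    case True
    then show False using d d' assms(2,3) by auto
  next
    case False
    consider "x / y \<in> R" | "y / x \<in> R" using valuation_ringD(6)[OF R, of "x / y"] by auto
    then show False
    proof cases
      case 1
      then have "inverse (x - y) * (x / y - 1) \<in> R"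
        using d R by (intro valuation_ringD(4,5) valuation_ring_one)
      moreover have "inverse (x - y) * (x / y - 1) = inverse y" using False d by (simp add: field_simps)
      ultimately show False using False assms(3) by simp
    next
      case 2
      then have "inverse (y - x) * (y / x - 1) \<in> R"
        using d' R by (intro valuation_ringD(4,5) valuation_ring_one)
      moreover have "inverse (y - x) * (y / x - 1) = inverse x" using False d by (simp add: field_simps)
      ultimately show False using False assms(2) by simp
    qed
  qed
qed

lemma nonunit_mult:
  assumes R: "valuation_ring K R" and "x = 0 \<or> inverse x \<notin> R" "y \<in> R"
  shows "x * y = 0 \<or> inverse (x * y) \<notin> R"
proof (rule ccontr)
  assume *: "\<not> (x * y = 0 \<or> inverse (x * y) \<notin> R)"
  then have "inverse (x * y) * y \<in> R" using assms by (intro valuation_ringD(5)) auto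
  moreover have "inverse (x * y) * y = inverse x" using * by (simp add: field_simps)
  ultimately have "inverse x \<in> R" by (simp only:)
  then show False using * assms(2) by auto
qed

text \<open>\<open>place_val\<close> describes its value through an arbitrary generator t of the
  place, so uniqueness rests on w t = 1 for every generator: t is a nonunit, hence w t is at least
  1, and t divides an element of value 1.\<close>

lemma place_val_eq:
  assumes R: "valuation_ring K R" and w: "discrete_valuation w"
    and Rw: "R = {z. z = 0 \<or> 0 \<le> w z}" and z: "z \<noteq> 0"
  shows "place_val (R - ring_units R) z = w z"
proof -
  interpret w: discrete_valuation w by (rule w)
  let ?P = "R - ring_units R"
  have P: "z \<in> ?P \<longleftrightarrow> z = 0 \<or> 1 \<le> w z" for z
    unfolding in_place_iff[OF R] using w.val_inverse[of z] by (cases "z = 0") (auto simp: Rw)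
  have U: "u \<in> ring_units R \<longleftrightarrow> u \<noteq> 0 \<and> w u = 0" for u
    using w.val_inverse[of u] by (cases "u = 0") (auto simp: ring_units_iff Rw)
  have prime: "t \<noteq> 0 \<and> w t = 1" if t: "?P = {t * a | a. a \<in> R}" for t
  proof -
    obtain \<pi> where \<pi>: "\<pi> \<noteq> 0" "w \<pi> = 1" using w.val_uniformizer by blast
    then have "\<pi> \<in> ?P" unfolding P by simp
    then obtain a where a: "\<pi> = t * a" "a \<in> R" unfolding t by blast
    with \<pi> have ne: "t \<noteq> 0" "a \<noteq> 0" by auto
    have "t * 1 \<in> ?P" unfolding t using valuation_ring_one[OF R] by blast
    then have "1 \<le> w t" using P ne by simp
    moreover have "w t + w a = 1" using a \<pi> w.val_mult[OF ne] by simp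
    ultimately show ?thesis using a ne Rw by auto
  qed
  obtain \<pi> where \<pi>: "\<pi> \<noteq> 0" "w \<pi> = 1" using w.val_uniformizer by blast
  have gen: "?P = {\<pi> * a | a. a \<in> R}"
  proof (intro set_eqI iffI)
    fix z assume "z \<in> ?P"
    then have "z / \<pi> \<in> R" using \<pi> w.val_divide[of z \<pi>] unfolding P
      by (cases "z = 0") (auto simp: Rw)
    then show "z \<in> {\<pi> * a | a. a \<in> R}" using \<pi> by (intro CollectI exI[of _ "z / \<pi>"]) simp
  next
    fix z assume "z \<in> {\<pi> * a | a. a \<in> R}"
    then obtain a where "z = \<pi> * a" "a = 0 \<or> 0 \<le> w a" unfolding Rw by blast
    then show "z \<in> ?P" using \<pi> w.val_mult[of \<pi> a] unfolding P by (cases "a = 0") auto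
  qed
  show ?thesis
    unfolding place_val_def place_ring_eq[OF R]
  proof (rule the_equality)
    have "z / \<pi> powi w z \<in> ring_units R"
      using z \<pi> by (simp add: U w.val_divide w.val_power_int)
    then show "\<exists>t u. ?P = {t * a | a. a \<in> R} \<and> u \<in> ring_units R \<and> z = t powi w z * u"
      using gen \<pi> by (intro exI[of _ \<pi>] exI[of _ "z / \<pi> powi w z"]) simp
  next
    fix n assume "\<exists>t u. ?P = {t * a | a. a \<in> R} \<and> u \<in> ring_units R \<and> z = t powi n * u"
    then obtain t u where tu: "?P = {t * a | a. a \<in> R}" "u \<in> ring_units R" "z = t powi n * u"
      by blast
    then show "n = w z"
      using prime[OF tu(1)] by (simp add: U w.val_mult w.val_power_int)
  qed
qed

text \<open>
  A surjective valuation is obtained from \<open>w\<close> by dividing by the smallest positive value.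
\<close>

lemma place_discrete_valuation:
  assumes R: "valuation_ring K R"
    and mult: "\<And>a b. a \<noteq> 0 \<Longrightarrow> b \<noteq> 0 \<Longrightarrow> w (a * b) = w a + (w b :: int)"
    and Rw: "R = {z. z = 0 \<or> 0 \<le> w z}"
  obtains e where "e > 0" "discrete_valuation (place_val (R - ring_units R))"
    "R = {z. z = 0 \<or> 0 \<le> place_val (R - ring_units R) z}"
    "\<forall>z. z \<noteq> 0 \<longrightarrow> w z = e * place_val (R - ring_units R) z"
proof -
  have w1: "w 1 = 0" using mult[of 1 1] by simp
  have winv: "w (inverse a) = - w a" if "a \<noteq> 0" for a
    using mult[of a "inverse a"] that w1 by simp
  have wpow: "w (a ^ n) = int n * w a" if "a \<noteq> 0" for a n
    using that by (induction n) (simp_all add: mult w1 algebra_simps)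
  have wpowi: "w (a powi n) = n * w a" if "a \<noteq> 0" for a n
    using that by (simp add: power_int_def wpow winv power_inverse)
  have ex: "\<exists>n t. t \<noteq> 0 \<and> w t = int n \<and> n > 0"
  proof -
    obtain z where "z \<notin> R" using valuation_ringD(2)[OF R] by blast
    then have "z \<noteq> 0" "w z < 0" by (auto simp: Rw)
    then show ?thesis
      by (intro exI[of _ "nat (- w z)"] exI[of _ "inverse z"]) (simp add: winv)
  qed
  define n0 where "n0 = (LEAST n. \<exists>t. t \<noteq> 0 \<and> w t = int n \<and> n > 0)"
  obtain t where t: "t \<noteq> 0" "w t = int n0" "n0 > 0"
    unfolding n0_def using LeastI_ex[OF ex] by blast
  have dvd: "int n0 dvd w z" if z: "z \<noteq> 0" for z
  proof (rule ccontr)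
    assume nd: "\<not> int n0 dvd w z"
    define s where "s = z * t powi (- (w z div int n0))"
    have s: "s \<noteq> 0" "w s = w z mod int n0"
      using z t by (simp_all add: s_def mult wpowi minus_mult_div_eq_mod mult.commute)
    have pos: "w z mod int n0 > 0"
      using nd t by (metis dvd_eq_mod_eq_0 of_nat_0_less_iff pos_mod_sign order_le_less)
    have "n0 \<le> nat (w s)" unfolding n0_def
      by (rule Least_le) (use s pos in auto)
    moreover have "w s < int n0" "w s > 0" using s t pos by simp_all
    ultimately show False by linarith
  qed
  define w0 where "w0 z = w z div int n0" for z
  have w0: "w z = int n0 * w0 z" if "z \<noteq> 0" for z
    using dvd[OF that] by (simp add: w0_def)
  have Rw0: "R = {z. z = 0 \<or> 0 \<le> w0 z}"
  proof -
    have "0 \<le> w z \<longleftrightarrow> 0 \<le> w0 z" if "z \<noteq> 0" for z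
      using t w0[OF that] by (simp add: zero_le_mult_iff)
    then show ?thesis unfolding Rw by blast
  qed
  have w0mult: "w0 (a * b) = w0 a + w0 b" if "a \<noteq> 0" "b \<noteq> 0" for a b
  proof -
    have "int n0 * w0 (a * b) = int n0 * (w0 a + w0 b)"
      using that mult[of a b] by (simp add: w0[symmetric] algebra_simps)
    then show ?thesis using t by simp
  qed
  have w0t: "w0 t = 1" using t by (simp add: w0_def)
  have DV: "discrete_valuation w0"
  proof
    fix a b :: 'a assume ab: "a \<noteq> 0" "b \<noteq> 0" "a + b \<noteq> 0"
    \<comment> \<open>\<open>w\<close> is assumed multiplicative only; the ultrametric inequality
      comes from R being closed under addition, applied to 1 + d / c with c the summand of smaller
      value.\<close>
    have *: "w0 c \<le> w0 (c + d)" if cd: "c \<noteq> 0" "d \<noteq> 0" "c + d \<noteq> 0" "w0 c \<le> w0 d" for c d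
    proof -
      have quot: "w0 (u * inverse c) = w0 u - w0 c" if "u \<noteq> 0" for u
        using w0mult[of "u * inverse c" c] that cd by (simp add: mult.assoc)
      have "d * inverse c \<in> R" using cd quot[of d] by (simp add: Rw0)
      then have "1 + d * inverse c \<in> R"
        using R by (intro valuation_ringD(3) valuation_ring_one)
      moreover have "1 + d * inverse c = (c + d) * inverse c" using cd by (simp add: field_simps)
      ultimately show ?thesis using cd quot[of "c + d"] by (auto simp: Rw0)
    qed
    show "min (w0 a) (w0 b) \<le> w0 (a + b)"
      using *[of a b] *[of b a] ab by (cases "w0 a \<le> w0 b") (auto simp: add.commute)
  qed (use w0mult w0t t in auto)
  have pv: "place_val (R - ring_units R) z = w0 z" if "z \<noteq> 0" for z
    by (rule place_val_eq[OF R DV Rw0 that])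
  interpret w0: discrete_valuation w0 by (rule DV)
  show thesis
  proof (rule that[of "int n0"])
    show "discrete_valuation (place_val (R - ring_units R))"
      by standard (use pv w0.val_mult w0.val_add t w0t in auto)
    show "R = {z. z = 0 \<or> 0 \<le> place_val (R - ring_units R) z}"
    proof (rule set_eqI)
      fix z
      have "z \<in> R \<longleftrightarrow> z = 0 \<or> 0 \<le> w0 z" unfolding Rw0 by blast
      then show "z \<in> R \<longleftrightarrow> z \<in> {z. z = 0 \<or> 0 \<le> place_val (R - ring_units R) z}"
        using pv[of z] by (cases "z = 0") auto
    qed
  qed (use t pv w0 in auto)
qed

section \<open>Existence of valuation rings\<close>

definition subring :: "'a::field set \<Rightarrow> bool" where
  "subring S \<longleftrightarrow> 1 \<in> S \<and> (\<forall>a\<in>S. \<forall>b\<in>S. a + b \<in> S \<and> a - b \<in> S \<and> a * b \<in> S)"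

lemma subringD:
  assumes "subring S"
  shows "1 \<in> S" "0 \<in> S" "a \<in> S \<Longrightarrow> b \<in> S \<Longrightarrow> a + b \<in> S" "a \<in> S \<Longrightarrow> b \<in> S \<Longrightarrow> a - b \<in> S"
    "a \<in> S \<Longrightarrow> b \<in> S \<Longrightarrow> a * b \<in> S"
  using assms unfolding subring_def by (blast, metis diff_self, blast+)

lemma subring_sum: "subring S \<Longrightarrow> (\<And>i. i \<in> A \<Longrightarrow> f i \<in> S) \<Longrightarrow> sum f A \<in> S"
  by (induction A rule: infinite_finite_induct) (auto intro: subringD)

lemma subring_power: "subring S \<Longrightarrow> a \<in> S \<Longrightarrow> a ^ n \<in> S"
  by (induction n) (auto intro: subringD)

definition adjoin :: "'a::field set \<Rightarrow> 'a \<Rightarrow> 'a set" where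
  "adjoin S t = {poly q t | q. \<forall>i. coeff q i \<in> S}"

lemma subring_adjoin:
  assumes S: "subring S"
  shows "subring (adjoin S t)"
  unfolding subring_def
proof (intro conjI ballI)
  show "1 \<in> adjoin S t" unfolding adjoin_def
    by (intro CollectI exI[of _ 1]) (auto simp: coeff_1 intro: subringD[OF S])
  fix a b assume "a \<in> adjoin S t" "b \<in> adjoin S t"
  then obtain p q where pq: "a = poly p t" "b = poly q t" "\<And>i. coeff p i \<in> S" "\<And>i. coeff q i \<in> S"
    unfolding adjoin_def by blast
  show "a + b \<in> adjoin S t" unfolding adjoin_def
    by (intro CollectI exI[of _ "p + q"]) (simp add: pq subringD[OF S])
  show "a - b \<in> adjoin S t" unfolding adjoin_def
    by (intro CollectI exI[of _ "p - q"]) (simp add: pq subringD[OF S])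
  have "coeff (p * q) i \<in> S" for i
    unfolding coeff_mult by (intro subring_sum subringD(5)[OF S] S pq)
  then show "a * b \<in> adjoin S t" unfolding adjoin_def
    by (intro CollectI exI[of _ "p * q"]) (simp add: pq)
qed

lemma adjoin_superset:
  assumes S: "subring S"
  shows "S \<subseteq> adjoin S t" "t \<in> adjoin S t"
proof -
  show "S \<subseteq> adjoin S t"
  proof
    fix a assume "a \<in> S"
    then show "a \<in> adjoin S t" unfolding adjoin_def
      by (intro CollectI exI[of _ "[:a:]"]) (auto simp: coeff_pCons subringD[OF S] split: nat.splits)
  qed
  show "t \<in> adjoin S t" unfolding adjoin_def
    by (intro CollectI exI[of _ "[:0, 1:]"]) (auto simp: coeff_pCons subringD[OF S] split: nat.splits)
qed

text \<open>
  A subring that contains \<open>z\<^sup>-\<^sup>1\<close> and is maximal among those not containing \<open>z\<close> is a valuation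
  ring: if neither \<open>t\<close> nor \<open>t\<^sup>-\<^sup>1\<close> lies in it, then \<open>1\<close> is a polynomial in \<open>t\<close> and also one in
  \<open>t\<^sup>-\<^sup>1\<close> with coefficients divisible by \<open>z\<^sup>-\<^sup>1\<close>; of two such relations of least degrees the
  shorter one reduces the degree of the longer one.
\<close>

lemma maximal_subring_valuation:
  fixes R :: "'a::field set"
  assumes R: "subring R" and z: "inverse z \<in> R" "z \<notin> R"
    and maximal: "\<And>S. subring S \<Longrightarrow> R \<subseteq> S \<Longrightarrow> z \<notin> S \<Longrightarrow> S = R"
  shows "t \<in> R \<or> inverse t \<in> R"
proof (rule ccontr)
  assume "\<not> (t \<in> R \<or> inverse t \<in> R)"
  then have tR: "t \<notin> R" "inverse t \<notin> R" by auto
  note [intro] = subringD[OF R] subring_power[OF R]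
  have z0: "z \<noteq> 0" using z subringD(2)[OF R] by auto
  have t0: "t \<noteq> 0" using tR subringD(2)[OF R] by auto
  \<comment> \<open>The ideal of R generated by z^-1; it is proper, as z is not in R.\<close>
  define I where "I = {x. z * x \<in> R}"
  have I_add: "a + b \<in> I" if "a \<in> I" "b \<in> I" for a b
    using that subringD(3)[OF R] by (simp add: I_def distrib_left)
  have I_diff: "a - b \<in> I" if "a \<in> I" "b \<in> I" for a b
    using that subringD(4)[OF R] by (simp add: I_def right_diff_distrib)
  have I_mult: "a * b \<in> I" if "a \<in> R" "b \<in> I" for a b
    using that subringD(5)[OF R, of a "z * b"] by (simp add: I_def algebra_simps)
  have I_0: "0 \<in> I" using subringD(2)[OF R] by (simp add: I_def)
  have I_R: "a \<in> R" if "a \<in> I" for a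
  proof -
    have "inverse z * (z * a) \<in> R" using that z by (auto simp: I_def)
    then show ?thesis using z0 by (simp flip: mult.assoc)
  qed
  have I_1: "1 \<notin> I" using z by (simp add: I_def)
  have I_sum: "sum f A \<in> I" if "\<And>i. i \<in> A \<Longrightarrow> f i \<in> I" for f :: "nat \<Rightarrow> 'a" and A
    using that by (induction A rule: infinite_finite_induct) (auto intro: I_0 I_add)
  \<comment> \<open>If u = 1 - c had no inverse in R, maximality would put z into R[u^-1]; clearing
    denominators gives u^n in I, although u^n is 1 modulo I.\<close>
  have unit: "inverse (1 - c) \<in> R" if c: "c \<in> I" for c
  proof (rule ccontr)
    let ?u = "1 - c"
    assume nR: "inverse ?u \<notin> R"
    have u0: "?u \<noteq> 0" using c I_1 by auto
    have "z \<in> adjoin R (inverse ?u)"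
      using maximal[OF subring_adjoin[OF R]] adjoin_superset[OF R, of "inverse ?u"] nR by blast
    then obtain q where q: "z = poly q (inverse ?u)" "\<And>i. coeff q i \<in> R"
      unfolding adjoin_def by blast
    define n where "n = degree q"
    have "z * ?u ^ n = (\<Sum>i\<le>n. coeff q i * ?u ^ (n - i))"
      unfolding q(1) poly_altdef n_def sum_distrib_right
    proof (rule sum.cong)
      fix i assume "i \<in> {..degree q}"
      then have "?u ^ degree q = ?u ^ i * ?u ^ (degree q - i)" by (simp flip: power_add)
      then show "coeff q i * inverse ?u ^ i * ?u ^ degree q = coeff q i * ?u ^ (degree q - i)"
        using u0 by (simp add: field_simps)
    qed simp
    also have "\<dots> \<in> R" using q(2) I_R[OF c] by (intro subring_sum[OF R]) auto
    finally have "?u ^ n \<in> I" by (simp add: I_def)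
    moreover have "1 - ?u ^ n \<in> I"
    proof (induction n)
      case (Suc n)
      have "?u ^ n * c \<in> I" using c I_R[OF c] by (intro I_mult) auto
      moreover have "1 - ?u ^ Suc n = (1 - ?u ^ n) + ?u ^ n * c" by (simp add: algebra_simps)
      ultimately show ?case using I_add[OF Suc] by metis
    qed (simp add: I_0)
    ultimately have "?u ^ n + (1 - ?u ^ n) \<in> I" by (rule I_add)
    then show False using I_1 by simp
  qed
  \<comment> \<open>\<open>E s n\<close> is a relation of degree at most n witnessing that I
    generates the unit ideal in R[s].\<close>
  define E where "E s n \<longleftrightarrow> (\<exists>c. (\<forall>i. c i \<in> I) \<and> (\<Sum>i\<le>n. c i * s ^ i) = 1)" for s and n :: nat
  have E_ex: "\<exists>n. E s n" if s: "s \<notin> R" for s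
  proof -
    have "z \<in> adjoin R s"
      using maximal[OF subring_adjoin[OF R]] adjoin_superset[OF R, of s] s by blast
    then obtain q where q: "z = poly q s" "\<And>i. coeff q i \<in> R" unfolding adjoin_def by blast
    have "(\<Sum>i\<le>degree q. (inverse z * coeff q i) * s ^ i) = inverse z * z"
      unfolding q(1) poly_altdef sum_distrib_left by (simp add: mult.assoc)
    moreover have "inverse z * coeff q i \<in> I" for i
      using q(2) z0 by (simp add: I_def flip: mult.assoc)
    ultimately show ?thesis unfolding E_def using z0
      by (intro exI[of _ "degree q"] exI[of _ "\<lambda>i. inverse z * coeff q i"]) simp
  qed
  have reduce: "\<exists>n'<n. E a n'" if ab: "a \<notin> R" "a * b = 1" and En: "E a n" and Ek: "E b k"
    and kn: "k \<le> n" for a b n k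
  proof -
    obtain c where c: "\<And>i. c i \<in> I" "(\<Sum>i\<le>n. c i * a ^ i) = 1" using En unfolding E_def by blast
    obtain d where d: "\<And>i. d i \<in> I" "(\<Sum>i\<le>k. d i * b ^ i) = 1" using Ek unfolding E_def by blast
    have "n \<noteq> 0"
    proof
      assume "n = 0"
      then have "c 0 = 1" using c(2) by simp
      then show False using c(1)[of 0] I_1 by simp
    qed
    then obtain n' where n: "n = Suc n'" by (cases n) auto
    \<comment> \<open>Since 1 - d 0 is a unit, the relation for b = 1 / a, multiplied by a^n,
      expresses a^n by lower powers of a. Substituting this into the relation for a lowers its
      degree.\<close>
    define u where "u = inverse (1 - d 0)"
    have u: "u \<in> R" unfolding u_def by (rule unit[OF d(1)])
    have "1 - d 0 \<noteq> 0" using d(1)[of 0] I_1 by auto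
    then have ud: "u * (1 - d 0) = 1" by (simp add: u_def)
    have "(\<Sum>i\<le>k. d i * b ^ i) = d 0 + (\<Sum>i\<in>{1..k}. d i * b ^ i)"
      by (simp add: sum.atMost_shift sum.atLeast1_atMost_eq lessThan_Suc_atMost)
    then have "(1 - d 0) = (\<Sum>i\<in>{1..k}. d i * b ^ i)" using d(2) by (simp add: algebra_simps)
    then have "a ^ n = a ^ n * (u * (\<Sum>i\<in>{1..k}. d i * b ^ i))" using ud by simp
    also have "\<dots> = (\<Sum>i\<in>{1..k}. u * d i * a ^ (n - i))"
      unfolding sum_distrib_left
    proof (rule sum.cong)
      fix i assume "i \<in> {1..k}"
      then have "a ^ n = a ^ (n - i) * a ^ i" using kn by (simp flip: power_add)
      moreover have "a ^ i * b ^ i = 1" using ab by (simp flip: power_mult_distrib)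
      ultimately show "a ^ n * (u * (d i * b ^ i)) = u * d i * a ^ (n - i)"
        by (simp add: algebra_simps)
    qed simp
    also have "\<dots> = (\<Sum>j\<le>n'. (if n - j \<le> k then u * d (n - j) else 0) * a ^ j)"
    proof -
      have "(\<Sum>i\<in>{1..k}. u * d i * a ^ (n - i))
          = (\<Sum>j\<in>{n - k..n'}. u * d (n - j) * a ^ j)"
        by (rule sum.reindex_bij_witness[of _ "\<lambda>j. n - j" "\<lambda>i. n - i"]) (use n kn in auto)
      also have "\<dots> = (\<Sum>j\<le>n'. (if n - j \<le> k then u * d (n - j) else 0) * a ^ j)"
        by (rule sum.mono_neutral_cong_left) (use n kn in auto)
      finally show ?thesis .
    qed
    finally have an: "a ^ n = (\<Sum>j\<le>n'. (if n - j \<le> k then u * d (n - j) else 0) * a ^ j)" .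
    define e where "e j = c j + c n * (if n - j \<le> k then u * d (n - j) else 0)" for j
    have "1 = (\<Sum>j\<le>n'. c j * a ^ j) + c n * a ^ n" using c(2) n by simp
    also have "\<dots> = (\<Sum>j\<le>n'. e j * a ^ j)"
      unfolding an e_def by (simp add: sum_distrib_left sum.distrib algebra_simps)
    finally have "(\<Sum>j\<le>n'. e j * a ^ j) = 1" by simp
    moreover have "e j \<in> I" for j
      unfolding e_def using c(1) d(1) u I_R by (intro I_add I_mult) (auto intro: I_mult I_0)
    ultimately show ?thesis using n unfolding E_def by blast
  qed
  define n where "n = (LEAST n. E t n)"
  define k where "k = (LEAST k. E (inverse t) k)"
  have n: "E t n" "\<And>n'. n' < n \<Longrightarrow> \<not> E t n'"
    unfolding n_def using LeastI_ex[OF E_ex[OF tR(1)]] not_less_Least by blast+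
  have k: "E (inverse t) k" "\<And>k'. k' < k \<Longrightarrow> \<not> E (inverse t) k'"
    unfolding k_def using LeastI_ex[OF E_ex[OF tR(2)]] not_less_Least by blast+
  show False
    using reduce[of t "inverse t" n k] reduce[of "inverse t" t k n] n k tR t0
    by (cases "k \<le> n") auto
qed

text \<open>Zorn's lemma among the subrings that contain A and miss z. With A = O[1/z] it detects
  failure of integrality, since z is integral over O exactly if z lies in O[1/z].\<close>

lemma exists_valuation_ring:
  fixes A :: "'a::field set"
  assumes A: "subring A" and z: "inverse z \<in> A" "z \<notin> A"
  obtains R where "subring R" "A \<subseteq> R" "z \<notin> R" "\<And>t. t \<in> R \<or> inverse t \<in> R"
proof -
  define C where "C = {S. subring S \<and> A \<subseteq> S \<and> z \<notin> S}"
  have "\<exists>M\<in>C. \<forall>X\<in>C. M \<subseteq> X \<longrightarrow> X = M"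
  proof (rule subset_Zorn_nonempty)
    show "C \<noteq> {}" using A z by (auto simp: C_def)
    fix D assume D: "D \<noteq> {}" "subset.chain C D"
    have DC: "S \<in> C" if "S \<in> D" for S using D that by (auto simp: subset.chain_def)
    have common: "\<exists>S\<in>D. a \<in> S \<and> b \<in> S" if "a \<in> \<Union>D" "b \<in> \<Union>D" for a b
    proof -
      obtain S T where "S \<in> D" "a \<in> S" "T \<in> D" "b \<in> T" using \<open>a \<in> \<Union>D\<close> \<open>b \<in> \<Union>D\<close> by blast
      moreover have "S \<subseteq> T \<or> T \<subseteq> S"
        using subset.chain_total[OF D(2)] \<open>S \<in> D\<close> \<open>T \<in> D\<close> by blast
      ultimately show ?thesis by blast
    qed
    have "subring (\<Union>D)"
      unfolding subring_def
    proof (intro conjI ballI)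
      show "1 \<in> \<Union>D" using D DC unfolding C_def subring_def by blast
      fix a b assume "a \<in> \<Union>D" "b \<in> \<Union>D"
      then obtain S where S: "S \<in> D" "a \<in> S" "b \<in> S" using common by blast
      then have "subring S" using DC by (simp add: C_def)
      from subringD(3-5)[OF this S(2,3)] S(1)
      show "a + b \<in> \<Union>D" "a - b \<in> \<Union>D" "a * b \<in> \<Union>D" by blast+
    qed
    then show "\<Union>D \<in> C" using D(1) DC unfolding C_def by blast
  qed
  then obtain R where R: "subring R" "A \<subseteq> R" "z \<notin> R"
    and maximal: "\<And>S. subring S \<Longrightarrow> R \<subseteq> S \<Longrightarrow> z \<notin> S \<Longrightarrow> S = R"
    unfolding C_def by (metis (mono_tags, lifting) mem_Collect_eq order.trans)
  show thesis
    by (rule that[OF R maximal_subring_valuation[OF R(1) _ R(3) maximal]]) (use R z in auto)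
qed

section \<open>The places of the rational function field\<close>

definition vfin :: "'k::field poly \<Rightarrow> 'k poly fract \<Rightarrow> int" where
  "vfin p z = (THE n. \<exists>a b. \<not> p dvd a \<and> \<not> p dvd b \<and>
     z = to_fract p powi n * (to_fract a / to_fract b))"

definition vinf :: "'k::field poly fract \<Rightarrow> int" where
  "vinf z = (THE n. \<exists>a b. a \<noteq> 0 \<and> b \<noteq> 0 \<and> z = to_fract a / to_fract b \<and>
     n = int (degree b) - int (degree a))"

text \<open>One normalized valuation for each place of K(x) over K;
  \<open>lies_over_base_valuation\<close> shows that every place of F lies over one of them.\<close>

definition base_valuations :: "('k::field poly fract \<Rightarrow> int) set" where
  "base_valuations = insert vinf {vfin p | p. irreducible p \<and> lead_coeff p = 1}"

lemma to_fract_power: "to_fract (a ^ n) = to_fract a ^ n"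
  by (induction n) simp_all

lemma fract_eq_quotient:
  obtains a b where "z = to_fract a / to_fract b" "b \<noteq> 0"
  by (cases z) (simp add: Fract_conv_to_fract)

lemma dvd_decompose:
  fixes a p :: "'k::field poly"
  assumes p: "prime_elem p" and a: "a \<noteq> 0"
  shows "\<exists>n b. a = p ^ n * b \<and> \<not> p dvd b"
  using a
proof (induction "degree a" arbitrary: a rule: less_induct)
  case less
  show ?case
  proof (cases "p dvd a")
    case False
    then show ?thesis by (intro exI[of _ 0] exI[of _ a]) simp
  next
    case True
    then obtain c where c: "a = p * c" by blast
    have "degree p > 0"
      using p by (metis is_unit_iff_degree neq0_conv prime_elem_def)
    then have "degree c < degree a" "c \<noteq> 0" using c less.prems by (auto simp: degree_mult_eq)
    from less.hyps[OF this] obtain n b where "c = p ^ n * b" "\<not> p dvd b" by blast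
    then show ?thesis using c by (intro exI[of _ "Suc n"] exI[of _ b]) simp
  qed
qed

context
  fixes p :: "'k::field poly"
  assumes p: "prime_elem p"
begin

lemma vfin_ex:
  assumes "z \<noteq> 0"
  obtains n a b where "\<not> p dvd a" "\<not> p dvd b" "z = to_fract p powi n * (to_fract a / to_fract b)"
proof -
  obtain a b where z: "z = to_fract a / to_fract b" "b \<noteq> 0" by (rule fract_eq_quotient)
  then have "a \<noteq> 0" using assms by auto
  then obtain i a' j b' where *: "a = p ^ i * a'" "\<not> p dvd a'" "b = p ^ j * b'" "\<not> p dvd b'"
    using dvd_decompose[OF p] z by metis
  show thesis
  proof (rule that[OF *(2,4), of "int i - int j"])
    have "p \<noteq> 0" using p by auto
    then show "z = to_fract p powi (int i - int j) * (to_fract a' / to_fract b')"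
      unfolding z * by (simp add: power_int_diff to_fract_power)
  qed
qed

lemma vfin_unique:
  assumes "\<not> p dvd a" "\<not> p dvd b" "\<not> p dvd c" "\<not> p dvd d"
    and eq: "to_fract p powi n * (to_fract a / to_fract b) = to_fract p powi m * (to_fract c / to_fract d)"
  shows "m \<le> n"
proof (rule ccontr)
  assume "\<not> m \<le> n"
  then obtain k where k: "m = n + int (Suc k)"
    by (metis add.commute diff_add_cancel not_le zless_iff_Suc_zadd)
  have p0: "to_fract p \<noteq> 0" using p by auto
  have ne: "b \<noteq> 0" "d \<noteq> 0" using assms by auto
  have "to_fract p powi n * (to_fract a / to_fract b)
      = to_fract p powi n * (to_fract p ^ Suc k * (to_fract c / to_fract d))"
    unfolding eq unfolding k power_int_add[OF disjI1[OF p0]] by (simp only: power_int_of_nat mult.assoc)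
  then have "to_fract a / to_fract b = to_fract p ^ Suc k * (to_fract c / to_fract d)"
    using p0 by (simp only: mult_cancel_left power_int_eq_0_iff) simp
  then have "to_fract a * to_fract d = to_fract p ^ Suc k * to_fract c * to_fract b"
    using ne by (simp add: field_simps)
  then have "a * d = p ^ Suc k * c * b"
    by (simp only: to_fract_power[symmetric] to_fract_mult[symmetric] to_fract_eq_iff)
  then have "p dvd a * d" by simp
  then show False using p assms by (simp add: prime_elem_dvd_mult_iff)
qed

lemma vfin_eq:
  assumes "\<not> p dvd a" "\<not> p dvd b"
  shows "vfin p (to_fract p powi n * (to_fract a / to_fract b)) = n"
  unfolding vfin_def
proof (rule the_equality)
  fix m assume "\<exists>c d. \<not> p dvd c \<and> \<not> p dvd d \<and>
    to_fract p powi n * (to_fract a / to_fract b) = to_fract p powi m * (to_fract c / to_fract d)"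
  then show "m = n" using assms vfin_unique by (metis order_antisym)
qed (use assms in blast)

lemma vfin_to_fract_self: "vfin p (to_fract p) = 1"
  using vfin_eq[of 1 1 1] p by (simp add: prime_elem_def)

lemma vfin_to_fract: "\<not> p dvd a \<Longrightarrow> vfin p (to_fract a) = 0"
  using vfin_eq[of a 1 0] p by (simp add: prime_elem_def)

lemma discrete_valuation_vfin: "discrete_valuation (vfin p)"
proof
  have p0: "to_fract p \<noteq> 0" using p by auto
  fix y z :: "'k poly fract" assume yz: "y \<noteq> 0" "z \<noteq> 0"
  obtain n a b where y: "\<not> p dvd a" "\<not> p dvd b" "y = to_fract p powi n * (to_fract a / to_fract b)"
    by (rule vfin_ex[OF yz(1)])
  obtain m c d where z: "\<not> p dvd c" "\<not> p dvd d" "z = to_fract p powi m * (to_fract c / to_fract d)"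
    by (rule vfin_ex[OF yz(2)])
  have nd: "\<not> p dvd a * c" "\<not> p dvd b * d" using p y z by (simp_all add: prime_elem_dvd_mult_iff)
  have "y * z = to_fract p powi (n + m) * (to_fract (a * c) / to_fract (b * d))"
    using p0 by (simp add: y z power_int_add)
  then show "vfin p (y * z) = vfin p y + vfin p z"
    unfolding y(3) z(3) by (simp only: vfin_eq[OF nd] vfin_eq[OF y(1,2)] vfin_eq[OF z(1,2)])
next
  have p0: "to_fract p \<noteq> 0" using p by auto
  fix y z :: "'k poly fract" assume "y \<noteq> 0" "z \<noteq> 0" "y + z \<noteq> 0"
  moreover have *: "vfin p y \<le> vfin p (y + z)"
    if yz: "y \<noteq> 0" "z \<noteq> 0" "y + z \<noteq> 0" "vfin p y \<le> vfin p z" for y z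
  proof -
    obtain n a b where y: "\<not> p dvd a" "\<not> p dvd b" "y = to_fract p powi n * (to_fract a / to_fract b)"
      by (rule vfin_ex[OF yz(1)])
    obtain m c d where z: "\<not> p dvd c" "\<not> p dvd d" "z = to_fract p powi m * (to_fract c / to_fract d)"
      by (rule vfin_ex[OF yz(2)])
    have vy: "vfin p y = n" and "vfin p z = m"
      unfolding y(3) z(3) by (simp_all only: vfin_eq[OF y(1,2)] vfin_eq[OF z(1,2)])
    then obtain k where k: "m = n + int k" using yz(4) by (metis zle_iff_zadd)
    have ne: "b \<noteq> 0" "d \<noteq> 0" using y z by auto
    let ?e = "a * d + p ^ k * c * b"
    have sum: "y + z = to_fract p powi n * (to_fract ?e / to_fract (b * d))"
      using p0 ne by (simp add: y z k power_int_add to_fract_power field_simps)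
    moreover have "?e \<noteq> 0"
    proof
      assume e0: "?e = 0"
      show False using sum yz(3) unfolding e0 by simp
    qed
    then obtain j e where e: "?e = p ^ j * e" "\<not> p dvd e" using dvd_decompose[OF p] by blast
    ultimately have "y + z = to_fract p powi (n + int j) * (to_fract e / to_fract (b * d))"
      using p0 by (simp add: power_int_add to_fract_power)
    moreover have "\<not> p dvd b * d" using p y z by (simp add: prime_elem_dvd_mult_iff)
    ultimately have "vfin p (y + z) = n + int j" using vfin_eq[OF e(2)] by metis
    then show ?thesis using vy by simp
  qed
  ultimately show "min (vfin p y) (vfin p z) \<le> vfin p (y + z)"
    using *[of y z] *[of z y]
    by (cases "vfin p y \<le> vfin p z") (simp_all add: add.commute min_def)
next
  show "\<exists>t. t \<noteq> 0 \<and> vfin p t = 1"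
    using vfin_to_fract_self p by (intro exI[of _ "to_fract p"]) auto
qed

text \<open>Together with \<open>vinf_pos_imp_infinite_place\<close> the link between the ideals in
  the statement and the valuations; it serves to find the valuation below \<open>Q\<close>.\<close>

lemma vfin_pos_imp_zero_place:
  assumes "z \<noteq> 0" "vfin p z > 0"
  shows "z \<in> zero_place p"
proof -
  obtain n a b where z: "\<not> p dvd a" "\<not> p dvd b" "z = to_fract p powi n * (to_fract a / to_fract b)"
    by (rule vfin_ex[OF assms(1)])
  then have "n > 0" using assms vfin_eq[OF z(1,2)] by metis
  then obtain k where k: "n = int (Suc k)" by (metis add_0 zless_iff_Suc_zadd)
  have "z = Fract (p ^ Suc k * a) b"
    unfolding z(3) k by (simp only: power_int_of_nat Fract_conv_to_fract to_fract_mult to_fract_power) simp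
  moreover have "p dvd p ^ Suc k * a" by simp
  ultimately show ?thesis unfolding zero_place_def using z(2) by blast
qed

end

lemma vinf_quotient:
  fixes a b :: "'k::field poly"
  assumes "a \<noteq> 0" "b \<noteq> 0"
  shows "vinf (to_fract a / to_fract b) = int (degree b) - int (degree a)"
  unfolding vinf_def
proof (rule the_equality)
  fix n assume "\<exists>c d. c \<noteq> 0 \<and> d \<noteq> 0 \<and> to_fract a / to_fract b = to_fract c / to_fract d \<and>
    n = int (degree d) - int (degree c)"
  then obtain c d where cd: "c \<noteq> 0" "d \<noteq> 0" "to_fract a / to_fract b = to_fract c / to_fract d"
    "n = int (degree d) - int (degree c)" by blast
  have "to_fract a * to_fract d = to_fract c * to_fract b"
    using cd(3) assms cd(1,2) by (simp add: field_simps)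
  then have "a * d = c * b" by (simp only: to_fract_mult[symmetric] to_fract_eq_iff)
  then have "degree a + degree d = degree c + degree b"
    using assms cd by (metis degree_mult_eq)
  then show "n = int (degree b) - int (degree a)" using cd(4) by simp
qed (use assms in blast)

lemma vinf_to_fract: "a \<noteq> 0 \<Longrightarrow> vinf (to_fract a) = - int (degree a)"
  using vinf_quotient[of a 1] by simp

lemma discrete_valuation_vinf: "discrete_valuation (vinf :: 'k::field poly fract \<Rightarrow> int)"
proof
  fix y z :: "'k poly fract" assume yz: "y \<noteq> 0" "z \<noteq> 0"
  obtain a b where y: "y = to_fract a / to_fract b" "b \<noteq> 0" by (rule fract_eq_quotient)
  obtain c d where z: "z = to_fract c / to_fract d" "d \<noteq> 0" by (rule fract_eq_quotient)
  have ne: "a \<noteq> 0" "c \<noteq> 0" using y z yz by auto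
  have "y * z = to_fract (a * c) / to_fract (b * d)" by (simp add: y z)
  then show "vinf (y * z) = vinf y + vinf z"
    using vinf_quotient[of "a * c" "b * d"] vinf_quotient[of a b] vinf_quotient[of c d] y z ne
    by (simp add: degree_mult_eq)
  assume yz': "y + z \<noteq> 0"
  let ?e = "a * d + c * b"
  have sum: "y + z = to_fract ?e / to_fract (b * d)" using y z by (simp add: field_simps)
  have "?e \<noteq> 0"
  proof
    assume e0: "?e = 0"
    show False using sum yz' unfolding e0 by simp
  qed
  then have "vinf (y + z) = int (degree b + degree d) - int (degree ?e)"
    unfolding sum using vinf_quotient[of ?e "b * d"] y z by (simp add: degree_mult_eq)
  moreover have "degree ?e \<le> max (degree a + degree d) (degree c + degree b)"
    using degree_add_le_max[of "a * d" "c * b"] ne y z by (simp add: degree_mult_eq)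
  moreover have "vinf y = int (degree b) - int (degree a)" "vinf z = int (degree d) - int (degree c)"
    using vinf_quotient y z ne by simp_all
  ultimately show "min (vinf y) (vinf z) \<le> vinf (y + z)" by linarith
next
  show "\<exists>t. t \<noteq> 0 \<and> vinf (t :: 'k poly fract) = 1"
    using vinf_quotient[of 1 "[:0, 1:] :: 'k poly"]
    by (intro exI[of _ "to_fract 1 / to_fract [:0, 1:]"]) simp
qed

lemma vinf_pos_imp_infinite_place:
  assumes "z \<noteq> 0" "vinf z > 0"
  shows "z \<in> infinite_place"
proof -
  obtain a b where z: "z = to_fract a / to_fract b" "b \<noteq> 0" by (rule fract_eq_quotient)
  then have "a \<noteq> 0" using assms by auto
  then have "degree a < degree b" using z assms vinf_quotient[of a b] by simp
  then show ?thesis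
    unfolding infinite_place_def z(1) using z(2) by (auto simp: Fract_conv_to_fract)
qed

lemma discrete_valuation_base: "v \<in> base_valuations \<Longrightarrow> discrete_valuation v"
  unfolding base_valuations_def
  using discrete_valuation_vinf discrete_valuation_vfin field_poly_irreducible_imp_prime by blast

lemma base_valuation_const:
  assumes "v \<in> base_valuations" "c \<noteq> 0"
  shows "v (const_fract c) = 0"
proof -
  have "\<not> p dvd [:c:]" if "irreducible p" for p
    using that assms(2) by (metis (no_types) dvd_trans irreducible_def is_unit_triv)
  then show ?thesis
    using assms unfolding base_valuations_def const_fract_def
    by (auto simp: vinf_to_fract vfin_to_fract field_poly_irreducible_imp_prime)
qed

lemma monic_irreducible_not_dvd:
  fixes p q :: "'k::field poly"
  assumes "irreducible p" "irreducible q" "lead_coeff p = 1" "lead_coeff q = 1" "p \<noteq> q"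
  shows "\<not> p dvd q"
proof
  assume "p dvd q"
  then obtain c where c: "q = p * c" by blast
  then have "is_unit c" using irreducibleD[OF assms(2) c] irreducible_not_unit[OF assms(1)] by blast
  then obtain a where "c = [:a:]" by (metis is_unit_polyE)
  moreover have "lead_coeff c = 1" using c assms by (simp add: lead_coeff_mult)
  ultimately show False using c assms by (simp add: one_pCons)
qed

text \<open>Witnesses are 1 / p, p and p / q. An element regular at v with a pole at w prevents one
  valuation ring of F from lying over both.\<close>

lemma base_valuations_separated:
  assumes "v \<in> base_valuations" "w \<in> base_valuations" "v \<noteq> w"
  shows "\<exists>h. h \<noteq> 0 \<and> v h > 0 \<and> w h < 0"
proof -
  have pos: "degree p > 0" if "irreducible p" for p :: "'a poly"
    using that by (metis irreducible_def is_unit_iff_degree neq0_conv)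
  note prime = field_poly_irreducible_imp_prime
  interpret inf: discrete_valuation "vinf :: 'a poly fract \<Rightarrow> int" by (rule discrete_valuation_vinf)
  consider p where "v = vinf" "w = vfin p" "irreducible p"
    | p where "v = vfin p" "w = vinf" "irreducible p"
    | p q where "v = vfin p" "w = vfin q" "irreducible p" "irreducible q"
        "lead_coeff p = 1" "lead_coeff q = 1"
    using assms unfolding base_valuations_def by blast
  then show ?thesis
  proof cases
    case 1
    interpret w: discrete_valuation w using assms(2) by (rule discrete_valuation_base)
    have "p \<noteq> 0" using 1 by auto
    then show ?thesis using 1 pos[OF 1(3)] vfin_to_fract_self[OF prime[OF 1(3)]]
      by (intro exI[of _ "inverse (to_fract p)"])
        (simp add: inf.val_inverse w.val_inverse[unfolded 1(2)] vinf_to_fract)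
  next
    case 2
    moreover have "p \<noteq> 0" using 2 by auto
    ultimately show ?thesis using pos[OF 2(3)] vfin_to_fract_self[OF prime[OF 2(3)]]
      by (intro exI[of _ "to_fract p"]) (simp add: vinf_to_fract)
  next
    case 3
    interpret v: discrete_valuation v using assms(1) by (rule discrete_valuation_base)
    interpret w: discrete_valuation w using assms(2) by (rule discrete_valuation_base)
    have "p \<noteq> q" using 3 assms by auto
    then have "v (to_fract q) = 0" "w (to_fract p) = 0" "v (to_fract p) = 1" "w (to_fract q) = 1"
      using 3 monic_irreducible_not_dvd[of p q] monic_irreducible_not_dvd[of q p]
      by (simp_all add: vfin_to_fract vfin_to_fract_self prime)
    moreover have "p \<noteq> 0" "q \<noteq> 0" using 3 by auto
    ultimately show ?thesis
      by (intro exI[of _ "to_fract p / to_fract q"]) (simp add: v.val_divide w.val_divide)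
  qed
qed

lemma exists_monic_irreducible_factor:
  fixes b :: "'k::field poly"
  assumes "degree b > 0"
  obtains p where "irreducible p" "lead_coeff p = 1" "p dvd b"
proof -
  have ex: "\<exists>n d. d dvd b \<and> degree d = n \<and> n > 0"
    by (intro exI[of _ "degree b"] exI[of _ b]) (use assms in simp)
  define n where "n = (LEAST n. \<exists>d. d dvd b \<and> degree d = n \<and> n > 0)"
  obtain d where d: "d dvd b" "degree d = n" "n > 0" unfolding n_def using LeastI_ex[OF ex] by blast
  have minimal: "n \<le> degree c" if "c dvd b" "degree c > 0" for c
    unfolding n_def by (rule Least_le) (use that in blast)
  have d0: "d \<noteq> 0" using d by auto
  let ?p = "smult (inverse (lead_coeff d)) d"
  have "irreducible d"
  proof (rule irreducibleI)
    fix a c assume ac: "d = a * c"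
    then have "a dvd b" "c dvd b" using d(1) by (auto dest: dvd_mult_left dvd_mult_right)
    then have "degree a = 0 \<or> n \<le> degree a" "degree c = 0 \<or> n \<le> degree c"
      using minimal by blast+
    moreover have "a \<noteq> 0" "c \<noteq> 0" "degree a + degree c = n" using ac d d0 by (auto simp: degree_mult_eq)
    ultimately show "is_unit a \<or> is_unit c" using d(3) by (auto simp: is_unit_iff_degree)
  qed (use d d0 in \<open>auto simp: is_unit_iff_degree\<close>)
  moreover have "?p = [:inverse (lead_coeff d):] * d" by simp
  moreover have "is_unit [:inverse (lead_coeff d):]" using d0 by (simp add: is_unit_iff_degree)
  ultimately have "irreducible ?p" by (metis irreducible_mult_unit_left)
  moreover have "lead_coeff ?p = 1" using d0 by simp
  moreover have "?p dvd b" using d(1) d0 by (simp add: smult_dvd_iff)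
  ultimately show thesis by (rule that)
qed

text \<open>Without finite poles z is a polynomial, and then \<open>vinf z\<close> is minus its
  degree: in a fraction with denominator of least degree, an irreducible factor of the denominator
  would either cancel or be a pole. This is the source of the degree arguments below.\<close>

lemma vinf_nonpos_if_vfin_nonneg:
  assumes "z \<noteq> 0" "\<And>p. irreducible p \<Longrightarrow> lead_coeff p = 1 \<Longrightarrow> 0 \<le> vfin p z"
  shows "vinf z \<le> 0"
proof -
  have ex: "\<exists>n a b. b \<noteq> 0 \<and> z = to_fract a / to_fract b \<and> degree b = n"
    using fract_eq_quotient by metis
  define n where "n = (LEAST n. \<exists>a b. b \<noteq> 0 \<and> z = to_fract a / to_fract b \<and> degree b = n)"
  obtain a b where ab: "b \<noteq> 0" "z = to_fract a / to_fract b" "degree b = n"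
    unfolding n_def using LeastI_ex[OF ex] by blast
  have minimal: "n \<le> degree d" if "d \<noteq> 0" "z = to_fract c / to_fract d" for c d
    unfolding n_def by (rule Least_le) (use that in blast)
  have a0: "a \<noteq> 0" using ab assms by auto
  have "n = 0"
  proof (rule ccontr)
    assume "n \<noteq> 0"
    then obtain p where p: "irreducible p" "lead_coeff p = 1" "p dvd b"
      using exists_monic_irreducible_factor[of b] ab by auto
    then obtain b' where b': "b = p * b'" by blast
    have prime: "prime_elem p" by (rule field_poly_irreducible_imp_prime[OF p(1)])
    have "degree p > 0" using p by (metis irreducible_def is_unit_iff_degree neq0_conv)
    then have lt: "degree b' < n" "b' \<noteq> 0" using ab b' by (auto simp: degree_mult_eq)
    have "\<not> p dvd a"
    proof
      assume "p dvd a"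
      then obtain a' where "a = p * a'" by blast
      then have "z = to_fract a' / to_fract b'" using ab b' by simp
      then show False using minimal lt by fastforce
    qed
    then have va: "vfin p (to_fract a) = 0" by (rule vfin_to_fract[OF prime])
    interpret v: discrete_valuation "vfin p" by (rule discrete_valuation_vfin[OF prime])
    obtain k c where k: "b' = p ^ k * c" "\<not> p dvd c" using dvd_decompose[OF prime lt(2)] by blast
    then have "b = p ^ Suc k * c" using b' by simp
    moreover have "c \<noteq> 0" "p \<noteq> 0" using k p by auto
    ultimately have "vfin p (to_fract b) = int (Suc k)"
      using vfin_to_fract_self[OF prime] vfin_to_fract[OF prime k(2)]
      by (simp only: to_fract_mult to_fract_power) (simp add: v.val_mult v.val_power)
    then have "vfin p z < 0" using ab a0 va by (simp add: v.val_divide)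
    then show False using assms(2)[OF p(1,2)] by simp
  qed
  then show ?thesis using ab a0 vinf_quotient[of a b] by simp
qed

section \<open>Radical extensions\<close>

locale field_hom =
  fixes \<iota> :: "'a::field \<Rightarrow> 'f::field"
  assumes hom_one [simp]: "\<iota> 1 = 1"
    and hom_add: "\<iota> (a + b) = \<iota> a + \<iota> b"
    and hom_mult: "\<iota> (a * b) = \<iota> a * \<iota> b"
begin

lemma hom_zero [simp]: "\<iota> 0 = 0"
  using hom_add[of 0 0] by (metis add_cancel_left_left add_0)

lemma hom_uminus: "\<iota> (- a) = - \<iota> a"
  using hom_add[of a "- a"] by (simp add: add_eq_0_iff2)

lemma hom_inverse: "\<iota> (inverse a) = inverse (\<iota> a)"
proof (cases "a = 0")
  case False
  then have "\<iota> a * \<iota> (inverse a) = 1" by (simp flip: hom_mult)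
  then show ?thesis by (metis inverse_unique)
qed simp

lemma hom_eq_0_iff [simp]: "\<iota> a = 0 \<longleftrightarrow> a = 0"
proof
  show "\<iota> a = 0 \<Longrightarrow> a = 0"
    using hom_mult[of a "inverse a"] by (cases "a = 0") auto
qed simp

lemma hom_power: "\<iota> (a ^ n) = \<iota> a ^ n"
  by (induction n) (simp_all add: hom_mult)

lemma hom_power_int: "\<iota> (a powi n) = \<iota> a powi n"
  by (simp add: power_int_def hom_power hom_inverse)

end

locale radical_extension = field_hom \<iota>
  for \<iota> :: "'a::field \<Rightarrow> 'f::field" +
  fixes m :: nat and g :: 'a and \<eta> :: 'f
  assumes m_pos: "m > 0"
    and radical: "\<eta> ^ m = \<iota> g"
    and generated: "generated_field (insert \<eta> (range \<iota>)) = UNIV"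
begin

sublocale vs: vector_space "\<lambda>a z. \<iota> a * z"
  by standard (simp_all add: hom_add hom_mult algebra_simps)

definition combination :: "(nat \<Rightarrow> 'a) \<Rightarrow> 'f" where
  "combination h = (\<Sum>i<m. \<iota> (h i) * \<eta> ^ i)"

lemma radical_power: "\<eta> ^ n = \<iota> (g ^ (n div m)) * \<eta> ^ (n mod m)"
  by (metis hom_power mult.commute mod_mult_div_eq power_add power_mult radical)

lemma combination_add: "combination h + combination k = combination (\<lambda>i. h i + k i)"
  by (simp add: combination_def hom_add sum.distrib algebra_simps)

lemma combination_scale: "\<iota> a * combination h = combination (\<lambda>i. a * h i)"
  by (simp add: combination_def hom_mult sum_distrib_left algebra_simps)

lemma combination_monomial:
  assumes "j < m"
  shows "combination (\<lambda>i. if i = j then a else 0) = \<iota> a * \<eta> ^ j"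
proof -
  have "combination (\<lambda>i. if i = j then a else 0) = (\<Sum>i<m. if i = j then \<iota> a * \<eta> ^ j else 0)"
    unfolding combination_def by (rule sum.cong) auto
  then show ?thesis using assms by simp
qed

lemma combination_sum: "(\<And>i. i \<in> A \<Longrightarrow> f i \<in> range combination) \<Longrightarrow> sum f A \<in> range combination"
proof (induction A rule: infinite_finite_induct)
  case (insert i A)
  then have "f i \<in> range combination" "sum f A \<in> range combination" by auto
  then obtain h k where "f i = combination h" "sum f A = combination k" by blast
  then show ?case using insert.hyps by (simp add: combination_add)
qed (auto simp: combination_def intro!: image_eqI[of _ _ "\<lambda>_. 0"])

lemma combination_mult:
  assumes "y \<in> range combination" "z \<in> range combination"
  shows "y * z \<in> range combination"
proof -
  obtain h k where hk: "y = combination h" "z = combination k" using assms by blast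
  have "\<iota> (h i) * \<eta> ^ i * (\<iota> (k j) * \<eta> ^ j) \<in> range combination" for i j
  proof -
    have "\<iota> (h i) * \<eta> ^ i * (\<iota> (k j) * \<eta> ^ j) = \<iota> (h i * k j) * \<eta> ^ (i + j)"
      by (simp add: hom_mult power_add algebra_simps)
    also have "\<dots> = \<iota> (h i * k j * g ^ ((i + j) div m)) * \<eta> ^ ((i + j) mod m)"
      unfolding hom_mult by (subst radical_power) (rule mult.assoc[symmetric])
    finally show ?thesis using combination_monomial[of "(i + j) mod m"] m_pos by (metis mod_less_divisor rangeI)
  qed
  then show ?thesis
    unfolding hk combination_def[of h] combination_def[of k] sum_product
    by (intro combination_sum)
qed

lemma combination_power: "z \<in> range combination \<Longrightarrow> z ^ n \<in> range combination"
proof (induction n)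
  case 0
  show ?case using combination_monomial[of 0 1] m_pos by (metis hom_one mult_1 power_0 rangeI)
qed (auto intro: combination_mult)

text \<open>F is spanned by m elements over K(x), so the m + 1 powers of z are dependent. Dependence
  is a property of sets, hence the separate case of a repeated power, where the relation is z^j -
  z^k = 0.\<close>

lemma power_relation:
  assumes z: "z \<in> range combination"
  obtains c j where "j \<le> m" "c j \<noteq> 0" "(\<Sum>i\<le>m. \<iota> (c i) * z ^ i) = 0"
proof (cases "inj_on (\<lambda>i. z ^ i) {..m}")
  case True
  let ?S = "(\<lambda>i. z ^ i) ` {..m}" and ?T = "(\<lambda>i. \<eta> ^ i) ` {..<m}"
  have "range combination \<subseteq> vs.span ?T"
    unfolding combination_def by (intro image_subsetI vs.span_sum vs.span_scale vs.span_base) auto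
  then have "?S \<subseteq> vs.span ?T" using combination_power[OF z] by blast
  moreover have "card ?S = Suc m" "card ?T \<le> m"
    using True card_image_le[of "{..<m}" "\<lambda>i. \<eta> ^ i"] by (simp_all add: card_image)
  ultimately have "vs.dependent ?S" using vs.independent_span_bound[of ?T ?S] by auto
  then obtain u v where u: "v \<in> ?S" "u v \<noteq> 0" "(\<Sum>v\<in>?S. \<iota> (u v) * v) = 0"
    using vs.dependent_finite[of ?S] by auto
  then have "(\<Sum>i\<le>m. \<iota> (u (z ^ i)) * z ^ i) = 0"
    using sum.reindex[OF True, of "\<lambda>v. \<iota> (u v) * v"] by simp
  then show thesis using that[of _ "\<lambda>i. u (z ^ i)"] u by auto
next
  case False
  then obtain j k where jk: "j \<noteq> k" "j \<le> m" "k \<le> m" "z ^ j = z ^ k"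
    unfolding inj_on_def by auto
  let ?c = "\<lambda>i. if i = j then 1 else if i = k then - 1 else 0"
  have "(\<Sum>i\<le>m. \<iota> (?c i) * z ^ i)
      = (\<Sum>i\<le>m. (if i = j then z ^ j else 0) + (if i = k then - (z ^ k) else 0))"
    using jk by (intro sum.cong) (auto simp: hom_uminus)
  also have "\<dots> = 0" using jk by (simp add: sum.distrib)
  finally show thesis using that[of j ?c] jk by simp
qed

text \<open>Dividing a relation by its lowest occurring power of z leaves an invertible constant
  term, so 1 / z is a polynomial in z.\<close>

lemma combination_inverse:
  assumes z: "z \<in> range combination"
  shows "inverse z \<in> range combination"
proof (cases "z = 0")
  case True
  then show ?thesis using z by simp
next
  case False
  obtain c j where c: "j \<le> m" "c j \<noteq> 0" "(\<Sum>i\<le>m. \<iota> (c i) * z ^ i) = 0"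
    by (rule power_relation[OF z])
  define n where "n = (LEAST j. c j \<noteq> 0)"
  have below: "c i = 0" if "i < n" for i
    using not_less_Least[of i "\<lambda>j. c j \<noteq> 0"] that unfolding n_def by auto
  have n: "c n \<noteq> 0" "n \<le> m"
    unfolding n_def using LeastI[of "\<lambda>j. c j \<noteq> 0", OF c(2)] Least_le[of "\<lambda>j. c j \<noteq> 0", OF c(2)] c(1)
    by auto
  let ?s = "\<Sum>i\<in>{Suc n..m}. \<iota> (c i) * z ^ (i - Suc n)"
  have "(\<Sum>i\<le>m. \<iota> (c i) * z ^ i) = (\<Sum>i\<in>{n..m}. \<iota> (c i) * z ^ i)"
    by (rule sum.mono_neutral_right) (auto simp: below)
  also have "\<dots> = \<iota> (c n) * z ^ n + (\<Sum>i\<in>{Suc n..m}. \<iota> (c i) * z ^ i)"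
    using n by (simp add: sum.atLeast_Suc_atMost)
  also have "(\<Sum>i\<in>{Suc n..m}. \<iota> (c i) * z ^ i) = z ^ Suc n * ?s"
    unfolding sum_distrib_left
  proof (rule sum.cong)
    fix i assume "i \<in> {Suc n..m}"
    then have "z ^ i = z ^ Suc n * z ^ (i - Suc n)" by (simp only: power_add[symmetric]) simp
    then show "\<iota> (c i) * z ^ i = z ^ Suc n * (\<iota> (c i) * z ^ (i - Suc n))" by simp
  qed simp
  finally have "z ^ n * (\<iota> (c n) + z * ?s) = 0" using c(3) by (simp add: algebra_simps)
  then have "z * ?s = - \<iota> (c n)" using False by (simp add: add_eq_0_iff2)
  then have "z * (\<iota> (- inverse (c n)) * ?s) = 1"
    using n by (simp add: hom_uminus hom_inverse mult.left_commute[of z])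
  then have inv: "inverse z = \<iota> (- inverse (c n)) * ?s" by (metis inverse_unique)
  have "?s \<in> range combination"
  proof (rule combination_sum)
    fix i
    obtain h where "z ^ (i - Suc n) = combination h" using combination_power[OF z] by blast
    then show "\<iota> (c i) * z ^ (i - Suc n) \<in> range combination" by (simp add: combination_scale)
  qed
  then obtain h where "?s = combination h" by blast
  then show ?thesis using inv combination_scale by simp
qed

lemma combination_surj: "\<exists>h. z = combination h"
proof -
  have base: "\<iota> a \<in> range combination" for a
    using combination_monomial[of 0 a] m_pos by (metis mult.right_neutral power_0 rangeI)
  have "\<eta> = \<iota> (g ^ (1 div m)) * \<eta> ^ (1 mod m)" using radical_power[of 1] by simp
  then have eta: "\<eta> \<in> range combination"
    using combination_monomial[of "1 mod m"] m_pos by (metis mod_less_divisor rangeI)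
  have "is_subfield (range combination)"
    unfolding is_subfield_def
  proof (intro conjI ballI)
    show "0 \<in> range combination" "1 \<in> range combination" using base[of 0] base[of 1] by auto
    fix a b assume ab: "a \<in> range combination" "b \<in> range combination"
    then show "a + b \<in> range combination" by (auto simp: combination_add)
    show "a * b \<in> range combination" using ab by (rule combination_mult)
  next
    fix a assume a: "a \<in> range combination"
    then show "- a \<in> range combination" "inverse a \<in> range combination"
      using combination_mult[OF base[of "- 1"] a] combination_inverse by (simp_all add: hom_uminus)
  qed
  then have "UNIV \<subseteq> range combination"
    using base eta unfolding generated[symmetric] generated_field_def by blast
  then show ?thesis by blast
qed

subsection \<open>Places above a discrete valuation\<close>

text \<open>F is integral over K(x) and valuation rings are integrally closed: one that contains the
  image of K(x) contains \<eta> along with \<eta>^m, hence all of F.\<close>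

lemma hom_range_not_subset:
  assumes R: "valuation_ring K R"
  shows "\<exists>a. \<iota> a \<notin> R"
proof (rule ccontr)
  assume "\<nexists>a. \<iota> a \<notin> R"
  then have all: "\<iota> b \<in> R" for b by blast
  have "\<eta> \<in> R" using all[of g] valuation_ring_power_iff[OF R m_pos] by (simp flip: radical)
  then have "combination h \<in> R" for h
    unfolding combination_def
    by (intro valuation_ring_sum[OF R] valuation_ringD(5)[OF R] all valuation_ring_power[OF R])
  then have "R = UNIV" using combination_surj by (metis UNIV_eq_I)
  then show False using valuation_ringD(2)[OF R] by simp
qed

definition lies_over :: "'f set \<Rightarrow> ('a \<Rightarrow> int) \<Rightarrow> bool" where
  "lies_over R v \<longleftrightarrow> (\<forall>a. a \<noteq> 0 \<longrightarrow> \<iota> a \<in> R \<longleftrightarrow> 0 \<le> v a)"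

text \<open>A discrete valuation ring is a maximal proper subring of its field: with one a of
  negative value in R, each b is b a^-n times a^n for large n, so R would contain all of
  K(x).\<close>

lemma lies_overI:
  assumes R: "valuation_ring K R" and v: "discrete_valuation v"
    and sub: "\<forall>a. a \<noteq> 0 \<longrightarrow> 0 \<le> v a \<longrightarrow> \<iota> a \<in> R"
  shows "lies_over R v"
  unfolding lies_over_def
proof (intro allI impI iffI, rule ccontr)
  interpret v: discrete_valuation v by (rule v)
  fix a assume a: "a \<noteq> 0" and aR: "\<iota> a \<in> R" and neg: "\<not> 0 \<le> v a"
  have all: "\<iota> b \<in> R" for b
  proof (cases "b = 0")
    case False
    define n where "n = nat \<bar>v b\<bar>"
    have "int n * v a \<le> int n * (- 1)" by (rule mult_left_mono) (use neg in simp_all)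
    moreover have "- int n \<le> v b" by (simp add: n_def)
    ultimately have "0 \<le> v b - int n * v a" by simp
    moreover have "v (b * inverse a ^ n) = v b - int n * v a"
      using False a by (simp add: v.val_mult v.val_power v.val_inverse)
    ultimately have "0 \<le> v (b * inverse a ^ n)" by simp
    then have "\<iota> (b * inverse a ^ n) * \<iota> a ^ n \<in> R"
      using sub a False aR R by (intro valuation_ringD(5)[OF R] valuation_ring_power[OF R]) auto
    then show ?thesis using a by (simp add: hom_mult hom_power hom_inverse power_inverse mult.assoc)
  qed (use R valuation_ring_zero in simp)
  then show False using hom_range_not_subset[OF R] by simp
qed (use sub in auto)

text \<open>Nonzero elements are totally preordered by whether their quotient lies in R; this gives
  a term of least value before any valuation on F exists.\<close>

lemma dominating_term:
  assumes R: "valuation_ring K R" and "finite A" "A \<noteq> {}" "\<And>i. i \<in> A \<Longrightarrow> f i \<noteq> 0"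
  shows "\<exists>i\<in>A. \<forall>j\<in>A. f j / f i \<in> R"
  using assms(2-)
proof (induction A rule: finite_ne_induct)
  case (singleton i)
  then show ?case using valuation_ring_one[OF R] by simp
next
  case (insert i A)
  then obtain k where k: "k \<in> A" "\<forall>j\<in>A. f j / f k \<in> R" by auto
  have ne: "f i \<noteq> 0" "f k \<noteq> 0" using insert k by auto
  show ?case
  proof (cases "f i / f k \<in> R")
    case True
    then show ?thesis using k by auto
  next
    case False
    then have ki: "f k / f i \<in> R" using valuation_ringD(6)[OF R, of "f i / f k"] by simp
    have "f j / f i \<in> R" if "j \<in> A" for j
      using valuation_ringD(5)[OF R k(2)[rule_format, OF that] ki] ne by simp
    then show ?thesis using ne valuation_ring_one[OF R] by auto
  qed
qed

text \<open>In a relation between powers of z two terms must share the least value; their quotient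
  shows that some \<iota> a * z^d with 1 \<le> d \<le> m is a unit. Hence the value of z, measured
  by v, is a fraction with bounded denominator, which makes the place discrete; e is the
  ramification index.\<close>

lemma place_over:
  assumes R: "valuation_ring K R" and v: "discrete_valuation v"
    and lies_over: "lies_over R v"
  obtains e where "e > 0" "discrete_valuation (place_val (R - ring_units R))"
    "R = {z. z = 0 \<or> 0 \<le> place_val (R - ring_units R) z}"
    "\<forall>a. a \<noteq> 0 \<longrightarrow> place_val (R - ring_units R) (\<iota> a) = e * v a"
proof -
  interpret v: discrete_valuation v by (rule v)
  have over: "\<iota> a \<in> R \<longleftrightarrow> 0 \<le> v a" if "a \<noteq> 0" for a
    using lies_over that by (simp add: lies_over_def)
  let ?U = "ring_units R"
  obtain \<pi> where \<pi>: "\<pi> \<noteq> 0" "v \<pi> = 1" using v.val_uniformizer by blast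
  have U_mult: "a * b \<in> ?U" if "a \<in> ?U" "b \<in> ?U" for a b
    using that valuation_ringD(5)[OF R] by (auto simp: ring_units_iff)
  have U_inverse: "inverse a \<in> ?U" if "a \<in> ?U" for a using that by (auto simp: ring_units_iff)
  have U_power: "a ^ n \<in> ?U" if "a \<in> ?U" for a n
    using that valuation_ring_power[OF R] by (auto simp: ring_units_iff simp flip: power_inverse)
  have U_hom: "\<iota> a \<in> ?U \<longleftrightarrow> v a = 0" if "a \<noteq> 0" for a
    using that over[of a] over[of "inverse a"] by (auto simp: ring_units_iff v.val_inverse hom_inverse)
  \<comment> \<open>A common multiple of all d in 1..m, so that N times the value of z is an integer
    for every z; \<open>W z n\<close> says that this integer is n.\<close>
  define N :: nat where "N = fact m"
  have N: "N > 0" by (simp add: N_def)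
  define W where "W z n \<longleftrightarrow> z ^ N / \<iota> (\<pi> powi n) \<in> ?U" for z n
  have unit_power: "\<exists>n. W z n" if z: "z \<noteq> 0" for z
  proof -
    obtain c j0 where c: "j0 \<le> m" "c j0 \<noteq> 0" "(\<Sum>i\<le>m. \<iota> (c i) * z ^ i) = 0"
      using power_relation combination_surj by (metis rangeI)
    define J where "J = {j. j \<le> m \<and> c j \<noteq> 0}"
    define f where "f j = \<iota> (c j) * z ^ j" for j
    have J: "finite J" "J \<noteq> {}" using c by (auto simp: J_def)
    have f: "f j \<noteq> 0" if "j \<in> J" for j using that z by (simp add: f_def J_def)
    have sum0: "sum f J = 0"
      using c(3) sum.mono_neutral_right[of "{..m}" J f] by (auto simp: J_def f_def)
    obtain i where i: "i \<in> J" "\<And>j. j \<in> J \<Longrightarrow> f j / f i \<in> R"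
      using dominating_term[OF R J, of f] f by blast
    \<comment> \<open>f i has least value and cancels against the rest, so a term f k of least value
      among the rest has the same value as f i.\<close>
    have rest: "sum f (J - {i}) = - f i" using sum0 i J by (simp add: sum_diff1)
    then have "J - {i} \<noteq> {}" using f[OF i(1)] by (metis neg_0_equal_iff_equal sum.empty)
    then obtain k where k: "k \<in> J" "k \<noteq> i" "\<And>j. j \<in> J - {i} \<Longrightarrow> f j / f k \<in> R"
      using dominating_term[OF R, of "J - {i}" f] J f by auto
    have "- (f i / f k) = (\<Sum>j\<in>J - {i}. f j / f k)" using rest by (simp flip: sum_divide_distrib)
    also have "\<dots> \<in> R" using k by (intro valuation_ring_sum[OF R])
    finally have "f i / f k \<in> R" using valuation_ring_minus[OF R] by fastforce
    then have unit: "f k / f i \<in> ?U" "f i / f k \<in> ?U"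
      using i(2)[OF k(1)] f i(1) k(1) by (simp_all add: ring_units_iff)
    have "\<exists>a d. a \<noteq> 0 \<and> d \<in> {1..m} \<and> \<iota> a * z ^ d \<in> ?U"
    proof -
      have *: "\<exists>a d. a \<noteq> 0 \<and> d \<in> {1..m} \<and> \<iota> a * z ^ d \<in> ?U"
        if "i \<in> J" "k \<in> J" "i < k" "f k / f i \<in> ?U" for i k
      proof (intro exI conjI)
        show "c k / c i \<noteq> 0" "k - i \<in> {1..m}" using that by (auto simp: J_def)
        have "z ^ k = z ^ i * z ^ (k - i)" using that by (simp flip: power_add)
        then have "f k / f i = \<iota> (c k / c i) * z ^ (k - i)"
          using z by (simp add: f_def divide_inverse hom_mult hom_inverse)
        then show "\<iota> (c k / c i) * z ^ (k - i) \<in> ?U" using that by simp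
      qed
      show ?thesis using *[of i k] *[of k i] i k unit by (cases "i < k") auto
    qed
    then obtain a d where ad: "a \<noteq> 0" "d \<in> {1..m}" "\<iota> a * z ^ d \<in> ?U" by blast
    have "d dvd N" unfolding N_def using ad by (intro dvd_fact) auto
    then obtain q where q: "N = d * q" by blast
    have "(\<iota> a * z ^ d) ^ q \<in> ?U" by (rule U_power[OF ad(3)])
    then have 1: "\<iota> (a ^ q) * z ^ N \<in> ?U" by (simp add: power_mult_distrib q power_mult hom_power)
    \<comment> \<open>The value that z^N must have, as a^q z^N is a unit.\<close>
    define n where "n = - (int q * v a)"
    have 2: "\<iota> (inverse (a ^ q * \<pi> powi n)) \<in> ?U"
      using ad \<pi> by (subst U_hom) (simp_all add: n_def v.val_inverse v.val_mult v.val_power v.val_power_int)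
    have "\<iota> (a ^ q) * z ^ N * \<iota> (inverse (a ^ q * \<pi> powi n)) = z ^ N / \<iota> (\<pi> powi n)"
      using ad by (simp add: hom_mult hom_inverse divide_inverse)
    then show ?thesis using U_mult[OF 1 2] unfolding W_def by metis
  qed
  have W_unique: "n = k" if "W z n" "W z k" "z \<noteq> 0" for z n k
  proof -
    have "z ^ N / \<iota> (\<pi> powi n) * inverse (z ^ N / \<iota> (\<pi> powi k)) \<in> ?U"
      using that U_mult U_inverse unfolding W_def by blast
    also have "z ^ N / \<iota> (\<pi> powi n) * inverse (z ^ N / \<iota> (\<pi> powi k)) = \<iota> (\<pi> powi k / \<pi> powi n)"
      using that \<pi> by (simp add: hom_mult hom_inverse divide_inverse)
    finally show ?thesis
      using \<pi> by (subst (asm) U_hom) (simp_all add: v.val_divide v.val_power_int)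
  qed
  define w where "w z = (THE n. W z n)" for z
  have w: "W z (w z)" if "z \<noteq> 0" for z
    using unit_power[OF that] W_unique that unfolding w_def by (metis theI)
  have w_eq: "w z = n" if "W z n" "z \<noteq> 0" for z n using w W_unique that by blast
  have w_mult: "w (a * b) = w a + w b" if "a \<noteq> 0" "b \<noteq> 0" for a b
  proof (rule w_eq)
    have "a ^ N / \<iota> (\<pi> powi w a) * (b ^ N / \<iota> (\<pi> powi w b)) \<in> ?U"
      using U_mult w that unfolding W_def by blast
    then show "W (a * b) (w a + w b)"
      using \<pi> by (simp add: W_def power_mult_distrib power_int_add hom_mult)
  qed (use that in simp)
  have w_hom: "w (\<iota> a) = int N * v a" if "a \<noteq> 0" for a
  proof (rule w_eq)
    have "\<iota> (a ^ N / \<pi> powi (int N * v a)) \<in> ?U"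
      using that \<pi> by (subst U_hom) (simp_all add: v.val_divide v.val_power v.val_power_int)
    then show "W (\<iota> a) (int N * v a)"
      by (simp add: W_def hom_mult hom_power hom_inverse divide_inverse)
  qed (use that in simp)
  have Rw: "R = {z. z = 0 \<or> 0 \<le> w z}"
  proof -
    have *: "z \<in> R \<longleftrightarrow> 0 \<le> w z" if z: "z \<noteq> 0" for z
    proof -
      let ?t = "\<iota> (\<pi> powi w z)"
      have t: "?t \<noteq> 0" using \<pi> by simp
      have u: "z ^ N / ?t \<in> R" "inverse (z ^ N / ?t) \<in> R"
        using w[OF z] by (simp_all add: W_def ring_units_iff)
      have "z ^ N \<in> R \<longleftrightarrow> ?t \<in> R"
        using valuation_ringD(5)[OF R u(1), of ?t] valuation_ringD(5)[OF R u(2), of "z ^ N"] t z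
        by auto
      also have "\<dots> \<longleftrightarrow> 0 \<le> w z" using \<pi> by (subst over) (simp_all add: v.val_power_int)
      finally show ?thesis using valuation_ring_power_iff[OF R N] by simp
    qed
    show ?thesis
    proof (rule set_eqI)
      fix z show "z \<in> R \<longleftrightarrow> z \<in> {z. z = 0 \<or> 0 \<le> w z}"
        using *[of z] valuation_ring_zero[OF R] by (cases "z = 0") simp_all
    qed
  qed
  obtain e0 where e0: "e0 > 0" "discrete_valuation (place_val (R - ring_units R))"
    "R = {z. z = 0 \<or> 0 \<le> place_val (R - ring_units R) z}"
    "\<forall>z. z \<noteq> 0 \<longrightarrow> w z = e0 * place_val (R - ring_units R) z"
    by (rule place_discrete_valuation[of K R w, OF R w_mult Rw])
  let ?p = "place_val (R - ring_units R)"
  \<comment> \<open>\<open>w\<close> is N times v on K(x) and e0 times the normalized valuation on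
    F; so on K(x) the latter is v times its value at a uniformizer of v.\<close>
  have N_eq: "int N = e0 * ?p (\<iota> \<pi>)" using e0(4)[rule_format, of "\<iota> \<pi>"] \<pi> w_hom[of \<pi>] by simp
  show thesis
  proof (rule that[OF _ e0(2,3)]; (intro allI impI)?)
    show "0 < ?p (\<iota> \<pi>)" using N_eq N e0(1) by (metis of_nat_0_less_iff zero_less_mult_pos)
    fix a :: 'a assume a: "a \<noteq> 0"
    have "e0 * ?p (\<iota> a) = e0 * (?p (\<iota> \<pi>) * v a)"
      using e0(4)[rule_format, of "\<iota> a"] a w_hom[OF a] N_eq by (metis hom_eq_0_iff mult.assoc)
    then show "?p (\<iota> a) = ?p (\<iota> \<pi>) * v a" using e0(1) by simp
  qed
qed

end


section \<open>Radical extensions of the rational function field\<close>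

lemma exists_power_cong_one:
  fixes a m :: nat
  assumes "coprime a m" "m > 0"
  shows "\<exists>d>0. [a ^ d = 1] (mod m)"
proof -
  have "\<not> inj (\<lambda>n. a ^ n mod m)"
  proof
    assume "inj (\<lambda>n. a ^ n mod m)"
    moreover have "finite (range (\<lambda>n. a ^ n mod m))"
      by (rule finite_subset[of _ "{..<m}"]) (use assms in auto)
    ultimately show False using range_inj_infinite by blast
  qed
  then obtain i j where "i < j" "a ^ i mod m = a ^ j mod m"
    unfolding inj_def by (metis linorder_neqE_nat)
  then have "[a ^ i * a ^ (j - i) = a ^ i * 1] (mod m)"
    by (simp add: cong_def flip: power_add)
  then have "[a ^ (j - i) = 1] (mod m)"
    using assms(1) by (subst (asm) cong_mult_lcancel_nat) simp_all
  then show ?thesis using \<open>i < j\<close> by (intro exI[of _ "j - i"]) simp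
qed

lemma const_fract_inverse: "const_fract (inverse c) = inverse (const_fract c)"
proof (cases "c = 0")
  case False
  then have "const_fract c * const_fract (inverse c) = 1"
    unfolding const_fract_def to_fract_mult[symmetric] by (simp flip: one_pCons)
  then show ?thesis by (metis inverse_unique)
qed (simp add: const_fract_def)

section \<open>Places of F over places of K(x)\<close>

locale radical_function_field = radical_extension \<iota> m g \<eta>
  for \<iota> :: "'k::field poly fract \<Rightarrow> 'f::field" and m g \<eta>
begin

abbreviation constants :: "'f set" where
  "constants \<equiv> range (\<iota> \<circ> const_fract)"

text \<open>The classification of the places of K(x), carried out on R directly. If x is in R, so is
  K[x], and the monic nonunit p of least degree generates the nonunits of K[x]; otherwise 1 / x is a
  nonunit and R lies over the pole of x.\<close>

lemma lies_over_base_valuation: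
  assumes R: "valuation_ring constants R"
  shows "\<exists>v\<in>base_valuations. lies_over R v"
proof -
  define \<phi> where "\<phi> a = \<iota> (to_fract a)" for a :: "'k poly"
  define X where "X = \<phi> [:0, 1:]"
  have \<phi>_add: "\<phi> (a + b) = \<phi> a + \<phi> b" and \<phi>_diff: "\<phi> (a - b) = \<phi> a - \<phi> b"
    and \<phi>_mult: "\<phi> (a * b) = \<phi> a * \<phi> b" for a b
    using hom_add[of "to_fract a" "- to_fract b"]
    by (simp_all add: \<phi>_def hom_add hom_mult hom_uminus)
  have \<phi>_0: "\<phi> a = 0 \<longleftrightarrow> a = 0" for a by (simp add: \<phi>_def)
  have \<phi>_pCons: "\<phi> (pCons c a) = \<phi> [:c:] + X * \<phi> a" for c a
    unfolding X_def \<phi>_mult[symmetric] \<phi>_add[symmetric] by simp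
  have const: "\<phi> [:c:] \<in> R" "inverse (\<phi> [:c:]) \<in> R" for c
    using valuation_ringD(1)[OF R]
    by (auto simp: \<phi>_def image_subset_iff const_fract_def[symmetric] hom_inverse[symmetric]
        const_fract_inverse[symmetric])
  have "\<exists>v\<in>base_valuations. \<forall>a. a \<noteq> 0 \<longrightarrow> 0 \<le> v a \<longrightarrow> \<iota> a \<in> R"
  proof (cases "X \<in> R")
    case True
    have in_R: "\<phi> a \<in> R" for a
    proof (induction a)
      case (pCons c a)
      then show ?case unfolding \<phi>_pCons[of c a]
        using True const R by (intro valuation_ringD(3,5))
    qed (use valuation_ring_zero[OF R] in \<open>simp add: \<phi>_def\<close>)
    have "\<exists>n a. a \<noteq> 0 \<and> inverse (\<phi> a) \<notin> R \<and> degree a = n"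
    proof (rule ccontr)
      assume "\<not> ?thesis"
      then have inv: "inverse (\<phi> a) \<in> R" if "a \<noteq> 0" for a using that by blast
      have "\<iota> z \<in> R" for z
      proof -
        obtain a b where z: "z = to_fract a / to_fract b" "b \<noteq> 0" by (rule fract_eq_quotient)
        have "\<phi> a * inverse (\<phi> b) \<in> R" using valuation_ringD(5)[OF R in_R inv[OF z(2)]] .
        then show ?thesis by (simp add: z \<phi>_def divide_inverse hom_mult hom_inverse)
      qed
      then show False using hom_range_not_subset[OF R] by blast
    qed
    note ex = this
    define n where "n = (LEAST n. \<exists>a. a \<noteq> 0 \<and> inverse (\<phi> a) \<notin> R \<and> degree a = n)"
    obtain p0 where p0: "p0 \<noteq> 0" "inverse (\<phi> p0) \<notin> R" "degree p0 = n"
      unfolding n_def using LeastI_ex[OF ex] by blast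
    have below: "inverse (\<phi> a) \<in> R" if "a \<noteq> 0" "degree a < n" for a
      using not_less_Least[of "degree a"] that unfolding n_def by blast
    define p where "p = smult (inverse (lead_coeff p0)) p0"
    have p_eq: "p = [:inverse (lead_coeff p0):] * p0" by (simp add: p_def)
    have p: "p \<noteq> 0" "degree p = n" "lead_coeff p = 1" using p0 by (auto simp: p_def)
    have p_nonunit: "inverse (\<phi> p) \<notin> R"
    proof
      assume "inverse (\<phi> p) \<in> R"
      then have "inverse (\<phi> p) * \<phi> [:inverse (lead_coeff p0):] \<in> R"
        using R const by (intro valuation_ringD(5))
      moreover have "inverse (\<phi> p) * \<phi> [:inverse (lead_coeff p0):] = inverse (\<phi> p0)"
      proof -
        have "\<phi> [:inverse (lead_coeff p0):] \<noteq> 0" unfolding \<phi>_0 using p0(1) by simp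
        then show ?thesis unfolding p_eq \<phi>_mult by simp
      qed
      ultimately show False using p0 by simp
    qed
    have "n > 0"
    proof (rule ccontr)
      assume "\<not> n > 0"
      then obtain c where "p0 = [:c:]" using p0(3) by (metis degree_eq_zeroE neq0_conv)
      then show False using p0(2) const by simp
    qed
    have irr: "irreducible p"
    proof (rule irreducibleI)
      show "p \<noteq> 0" by (rule p)
      show "\<not> is_unit p" using p \<open>n > 0\<close> by (simp add: is_unit_iff_degree)
      fix b c assume bc: "p = b * c"
      then have ne: "b \<noteq> 0" "c \<noteq> 0" using p by auto
      show "is_unit b \<or> is_unit c"
      proof (rule ccontr)
        assume "\<not> (is_unit b \<or> is_unit c)"
        then have "degree b < n" "degree c < n"
          using ne bc p by (auto simp: is_unit_iff_degree degree_mult_eq)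
        then have "inverse (\<phi> b) * inverse (\<phi> c) \<in> R"
          using below ne by (intro valuation_ringD(5)[OF R]) auto
        then show False using p_nonunit unfolding bc \<phi>_mult by simp
      qed
    qed
    \<comment> \<open>The remainder of b modulo p is nonzero of smaller degree, hence a unit of R;
      but it would be a difference of nonunits if b were one.\<close>
    have unit: "inverse (\<phi> b) \<in> R" if b: "\<not> p dvd b" for b
    proof (rule ccontr)
      assume nb: "inverse (\<phi> b) \<notin> R"
      define r where "r = b mod p"
      have r: "r \<noteq> 0" "degree r < n"
        using b p degree_mod_less[of p b] by (auto simp: r_def mod_eq_0_iff_dvd)
      have "\<phi> r = \<phi> b - \<phi> p * \<phi> (b div p)"
        unfolding \<phi>_mult[symmetric] \<phi>_diff[symmetric] r_def by (simp add: minus_mult_div_eq_mod)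
      then have "\<phi> r = 0 \<or> inverse (\<phi> r) \<notin> R"
        using nonunit_diff[OF R _ nonunit_mult[OF R _ in_R]] nb p_nonunit by metis
      then show False using below[OF r] r \<phi>_0 by simp
    qed
    have "vfin p \<in> base_valuations" using irr p by (auto simp: base_valuations_def)
    moreover have "\<iota> z \<in> R" if z: "z \<noteq> 0" "0 \<le> vfin p z" for z
    proof -
      note prime = field_poly_irreducible_imp_prime[OF irr]
      obtain k a b where ab: "\<not> p dvd a" "\<not> p dvd b" "z = to_fract p powi k * (to_fract a / to_fract b)"
        by (rule vfin_ex[OF prime z(1)])
      then have "0 \<le> k" using z(2) vfin_eq[OF prime ab(1,2)] by metis
      then have "\<iota> z = \<phi> p ^ nat k * \<phi> a * inverse (\<phi> b)"
        unfolding ab(3) by (simp add: \<phi>_def power_int_def hom_mult hom_inverse hom_power divide_inverse)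
      then show ?thesis
        using valuation_ringD(5)[OF R] valuation_ring_power[OF R] in_R unit[OF ab(2)] by metis
    qed
    ultimately show ?thesis by blast
  next
    case False
    define Y where "Y = inverse X"
    have Y: "Y \<in> R" "inverse Y \<notin> R" "X \<noteq> 0"
      using False valuation_ringD(6)[OF R, of X] valuation_ring_zero[OF R] by (auto simp: Y_def)
    have XY: "X * Y = 1" using Y by (simp add: Y_def)
    have step: "\<phi> (pCons c a) * Y ^ Suc n = \<phi> [:c:] * Y ^ Suc n + \<phi> a * Y ^ n" for c a n
      unfolding \<phi>_pCons[of c a] using XY by (simp add: algebra_simps)
    have in_R: "\<phi> a * Y ^ n \<in> R" if "degree a \<le> n" for a n
      using that
    proof (induction a arbitrary: n)
      case 0
      then show ?case using valuation_ring_zero[OF R] by (simp add: \<phi>_def)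
    next
      case (pCons c a)
      show ?case
      proof (cases "a = 0")
        case True
        then show ?thesis using const Y R by (auto intro: valuation_ringD(5) valuation_ring_power)
      next
        case False
        then obtain k where k: "n = Suc k" "degree a \<le> k" using pCons.prems by (cases n) auto
        show ?thesis
          unfolding k(1) using pCons.IH[OF k(2)] valuation_ring_power[OF R Y(1)] const(1)
          by (subst step) (metis valuation_ringD(3,5)[OF R])
      qed
    qed
    \<comment> \<open>\<phi> a * Y^(degree a) is the reflected polynomial in the nonunit Y; its
      constant term is the leading coefficient of a, a nonzero constant and so a unit.\<close>
    have unit: "inverse (\<phi> a * Y ^ degree a) \<in> R" if "a \<noteq> 0" for a
      using that
    proof (induction a)
      case (pCons c a)
      show ?case
      proof (cases "a = 0")
        case True
        then show ?thesis using const by simp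
      next
        case False
        let ?n = "degree a"
        show ?thesis
        proof (rule ccontr)
          assume *: "inverse (\<phi> (pCons c a) * Y ^ degree (pCons c a)) \<notin> R"
          have "\<phi> [:c:] * Y ^ ?n \<in> R" using const Y R by (intro valuation_ringD(5) valuation_ring_power)
          from nonunit_mult[OF R _ this, of Y] Y(2)
          have "Y * (\<phi> [:c:] * Y ^ ?n) = 0 \<or> inverse (Y * (\<phi> [:c:] * Y ^ ?n)) \<notin> R" by simp
          from nonunit_diff[OF R _ this, of "\<phi> (pCons c a) * Y ^ Suc ?n"] * False
          have "\<phi> (pCons c a) * Y ^ Suc ?n - Y * (\<phi> [:c:] * Y ^ ?n) = 0 \<or>
            inverse (\<phi> (pCons c a) * Y ^ Suc ?n - Y * (\<phi> [:c:] * Y ^ ?n)) \<notin> R" by simp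
          moreover have "\<phi> (pCons c a) * Y ^ Suc ?n - Y * (\<phi> [:c:] * Y ^ ?n) = \<phi> a * Y ^ ?n"
            by (subst step) (simp add: algebra_simps)
          ultimately have "\<phi> a * Y ^ ?n = 0 \<or> inverse (\<phi> a * Y ^ ?n) \<notin> R" by (simp only:)
          then show False using pCons.IH[OF False] False \<phi>_0[of a] XY by auto
        qed
      qed
    qed simp
    have "\<iota> z \<in> R" if z: "z \<noteq> 0" "0 \<le> vinf z" for z
    proof -
      obtain a b where ab: "z = to_fract a / to_fract b" "b \<noteq> 0" by (rule fract_eq_quotient)
      then have "a \<noteq> 0" using z by auto
      then have "degree a \<le> degree b" using vinf_quotient[of a b] ab z by simp
      then have "\<phi> a * Y ^ degree b * inverse (\<phi> b * Y ^ degree b) \<in> R"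
        using in_R unit[OF ab(2)] valuation_ringD(5)[OF R] by blast
      moreover have "\<phi> a * Y ^ degree b * inverse (\<phi> b * Y ^ degree b) = \<phi> a * inverse (\<phi> b)"
        using XY \<phi>_0[of b] ab(2) by (auto simp: field_simps)
      ultimately have "\<phi> a * inverse (\<phi> b) \<in> R" by (simp only:)
      then show ?thesis
        by (simp add: ab \<phi>_def hom_mult hom_inverse divide_inverse)
    qed
    then show ?thesis by (intro bexI[of _ vinf]) (auto simp: base_valuations_def)
  qed
  then show ?thesis using lies_overI[OF R] discrete_valuation_base by blast
qed

section \<open>Integrality over a discrete valuation ring of K(x)\<close>

lemma integral_if_in_all_valuation_rings:
  assumes v: "v \<in> base_valuations"
    and all: "\<And>R. valuation_ring constants R \<Longrightarrow> lies_over R v \<Longrightarrow> z \<in> R"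
  obtains n c where "\<And>i. c i = 0 \<or> 0 \<le> v (c i)" "z ^ n = (\<Sum>i<n. \<iota> (c i) * z ^ i)"
proof (cases "z = 0")
  case True
  then show thesis by (intro that[of "\<lambda>_. 0" 1]) simp_all
next
  case False
  interpret v: discrete_valuation v by (rule discrete_valuation_base[OF v])
  let ?O = "\<iota> ` v.val_ring"
  have O: "subring ?O"
    unfolding subring_def
  proof (intro conjI ballI)
    show "1 \<in> ?O" using v.one_in_val_ring by (metis hom_one imageI)
    fix a b assume "a \<in> ?O" "b \<in> ?O"
    then obtain c d where cd: "a = \<iota> c" "b = \<iota> d" "c \<in> v.val_ring" "d \<in> v.val_ring" by blast
    show "a + b \<in> ?O" "a * b \<in> ?O"
      using cd v.val_ring_closed by (auto simp flip: hom_add hom_mult)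
    have "c + - d \<in> v.val_ring" using cd v.val_ring_closed by blast
    moreover have "a - b = \<iota> (c + - d)" by (simp only: cd hom_add hom_uminus) simp
    ultimately show "a - b \<in> ?O" by blast
  qed
  let ?A = "adjoin ?O (inverse z)"
  \<comment> \<open>Otherwise some valuation ring contains O[1/z] and misses z; it lies over v
    because it contains O, which contradicts the regularity of z.\<close>
  have "z \<in> ?A"
  proof (rule ccontr)
    assume "z \<notin> ?A"
    then obtain R where R: "subring R" "?A \<subseteq> R" "z \<notin> R" "\<And>t. t \<in> R \<or> inverse t \<in> R"
      using exists_valuation_ring[OF subring_adjoin[OF O] adjoin_superset(2)[OF O]] by metis
    have OR: "?O \<subseteq> R" using adjoin_superset(1)[OF O] R(2) by blast
    obtain \<pi> where \<pi>: "\<pi> \<noteq> 0" "v \<pi> = 1" using v.val_uniformizer by blast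
    have "const_fract c \<in> v.val_ring" for c
      using base_valuation_const[OF v, of c]
      by (cases "c = 0") (auto simp: v.val_ring_def const_fract_def)
    then have "constants \<subseteq> R" using OR by auto
    moreover have "\<iota> \<pi> \<in> R" using OR \<pi> by (auto simp: v.val_ring_def)
    \<comment> \<open>\<open>valuation_ring\<close> asks for a proper inclusion of the constants; a
      uniformizer has value 1, a nonzero constant value 0.\<close>
    moreover have "\<iota> \<pi> \<notin> constants"
    proof
      assume "\<iota> \<pi> \<in> constants"
      then obtain c where "\<iota> \<pi> = \<iota> (const_fract c)" by auto
      then have "\<iota> (\<pi> + - const_fract c) = 0" unfolding hom_add hom_uminus by simp
      then have c: "\<pi> = const_fract c" by (simp only: hom_eq_0_iff) simp
      then have "c \<noteq> 0" using \<pi> by (auto simp: const_fract_def)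
      then show False using c \<pi> base_valuation_const[OF v] by simp
    qed
    ultimately have "constants \<subset> R" by blast
    then have "valuation_ring constants R"
      unfolding valuation_ring_def using R(3,4) subringD(3-5)[OF R(1)]
      by (intro conjI ballI allI) auto
    moreover from this have "lies_over R v"
      using OR by (intro lies_overI v.discrete_valuation_axioms) (auto simp: v.val_ring_def)
    ultimately show False using all R(3) by blast
  qed
  then obtain q where q: "z = poly q (inverse z)" "\<And>i. coeff q i \<in> ?O" unfolding adjoin_def by blast
  then have "\<forall>i. \<exists>c. coeff q i = \<iota> c \<and> c \<in> v.val_ring" by blast
  then obtain c where c: "\<And>i. coeff q i = \<iota> (c i)" "\<And>i. c i \<in> v.val_ring" by metis
  let ?n = "degree q"
  \<comment> \<open>Multiplication by z^(deg q) turns the relation into a monic equation of degree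
    deg q + 1, with the coefficients of q in reverse order.\<close>
  have "z ^ Suc ?n = z ^ ?n * poly q (inverse z)" using q(1) by simp
  also have "\<dots> = (\<Sum>i\<le>?n. \<iota> (c i) * z ^ (?n - i))"
    unfolding poly_altdef sum_distrib_left c(1)
  proof (rule sum.cong)
    fix i assume "i \<in> {..?n}"
    then have "z ^ ?n = z ^ (?n - i) * z ^ i" by (simp flip: power_add)
    then show "z ^ ?n * (\<iota> (c i) * inverse z ^ i) = \<iota> (c i) * z ^ (?n - i)"
      using False by (simp add: field_simps)
  qed simp
  also have "\<dots> = (\<Sum>i<Suc ?n. \<iota> (c (?n - i)) * z ^ i)"
    by (rule sum.reindex_bij_witness[of _ "\<lambda>i. ?n - i" "\<lambda>i. ?n - i"]) auto
  finally show thesis using c(2) by (intro that[of "\<lambda>i. c (?n - i)" "Suc ?n"]) (auto simp: v.val_ring_def)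
qed

text \<open>The powers of z stay in the module spanned by 1, ..., z^(n-1) over the valuation ring of
  v, so a bound on the denominators of these finitely many elements serves all powers.\<close>

lemma integral_powers_bounded:
  assumes v: "discrete_valuation v" and c: "\<And>i. c i = 0 \<or> 0 \<le> v (c i)"
    and z: "z ^ n = (\<Sum>i<n. \<iota> (c i) * z ^ i)"
  shows "\<exists>B. \<forall>k. \<exists>h. z ^ k = combination h \<and> (\<forall>i<m. h i = 0 \<or> B \<le> v (h i))"
proof -
  interpret v: discrete_valuation v by (rule v)
  have "\<forall>j. \<exists>h. z ^ j = combination h" using combination_surj by blast
  then obtain H where H: "\<And>j. z ^ j = combination (H j)" by metis
  \<comment> \<open>Minus a sum of absolute values is a common lower bound and avoids a minimum over
    a possibly empty set.\<close>
  define B where "B = - (\<Sum>j<n. \<Sum>i<m. \<bar>v (H j i)\<bar>)"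
  define M where "M = {combination h | h. \<forall>i<m. h i = 0 \<or> B \<le> v (h i)}"
  have M_add: "x + y \<in> M" if xy: "x \<in> M" "y \<in> M" for x y
  proof -
    obtain h k where hk: "x = combination h" "y = combination k"
      "\<forall>i<m. h i = 0 \<or> B \<le> v (h i)" "\<forall>i<m. k i = 0 \<or> B \<le> v (k i)"
      using xy unfolding M_def by blast
    have "h i + k i = 0 \<or> B \<le> v (h i + k i)" if "i < m" for i
      using v.val_sum_ge[of "{True, False}" "\<lambda>b. if b then h i else k i" B] hk that by auto
    then show ?thesis unfolding M_def hk combination_add by blast
  qed
  have M_scale: "\<iota> (c i) * x \<in> M" if x: "x \<in> M" for x i
  proof -
    obtain h where h: "x = combination h" "\<forall>i<m. h i = 0 \<or> B \<le> v (h i)"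
      using x unfolding M_def by blast
    have "c i * h j = 0 \<or> B \<le> v (c i * h j)" if "j < m" for j
      using h(2)[rule_format, OF that] c[of i] by (cases "c i = 0 \<or> h j = 0") (auto simp: v.val_mult)
    then show ?thesis unfolding M_def h combination_scale by blast
  qed
  have M_0: "0 \<in> M" unfolding M_def combination_def by (intro CollectI exI[of _ "\<lambda>_. 0"]) simp
  have M_sum: "sum f A \<in> M" if "\<And>i. i \<in> A \<Longrightarrow> f i \<in> M" for f :: "nat \<Rightarrow> 'f" and A
    using that by (induction A rule: infinite_finite_induct) (auto intro: M_0 M_add)
  have "z ^ k \<in> M" for k
  proof (induction k rule: less_induct)
    case (less k)
    show ?case
    proof (cases "k < n")
      case True
      have "B \<le> v (H k i)" if "i < m" for i
      proof -
        have "\<bar>v (H k i)\<bar> \<le> (\<Sum>i<m. \<bar>v (H k i)\<bar>)" by (rule member_le_sum) (use that in auto)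
        also have "\<dots> \<le> (\<Sum>j<n. \<Sum>i<m. \<bar>v (H j i)\<bar>)"
          by (rule member_le_sum) (use True in \<open>auto intro: sum_nonneg\<close>)
        finally show ?thesis unfolding B_def by linarith
      qed
      then show ?thesis unfolding M_def H[of k] by blast
    next
      case False
      have "z ^ k = z ^ (k - n) * (\<Sum>i<n. \<iota> (c i) * z ^ i)"
        using False by (simp flip: z power_add)
      also have "\<dots> = (\<Sum>i<n. \<iota> (c i) * z ^ (k - n + i))"
        by (simp add: sum_distrib_left power_add algebra_simps)
      also have "\<dots> \<in> M" by (intro M_sum M_scale less) (use False in auto)
      finally show ?thesis .
    qed
  qed
  then show ?thesis unfolding M_def by blast
qed

text \<open>
  In place of the trace form or of a Galois group: a power \<open>P = 1 + m t\<close> of the characteristic acts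
  on \<open>\<Sum> h\<^sub>i \<eta>\<^sup>i\<close> by \<open>h\<^sub>i \<mapsto> h\<^sub>i\<^sup>P g\<^sup>i\<^sup>t\<close>, so the coefficients of an element whose powers have
  bounded denominators satisfy \<open>v h\<^sub>i + (i/m) v g \<ge> 0\<close>, as is seen by letting \<open>P\<close> tend to infinity.
\<close>

lemma frobenius_combination:
  assumes "prime CHAR('f)" "CHAR('f) ^ k = 1 + m * t"
  shows "combination h ^ (CHAR('f) ^ k) = combination (\<lambda>i. h i ^ (CHAR('f) ^ k) * g ^ (i * t))"
proof -
  let ?P = "CHAR('f) ^ k"
  have "combination h ^ ?P = (\<Sum>i<m. (\<iota> (h i) * \<eta> ^ i) ^ ?P)"
    unfolding combination_def by (rule freshmans_dream_sum'[OF assms(1) refl])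
  also have "\<dots> = combination (\<lambda>i. h i ^ ?P * g ^ (i * t))"
    unfolding combination_def
  proof (rule sum.cong)
    fix i
    have "(\<eta> ^ i) ^ ?P = \<eta> ^ (i + m * (i * t))" unfolding assms(2) power_mult[symmetric]
      by (simp add: algebra_simps)
    also have "\<dots> = \<iota> (g ^ (i * t)) * \<eta> ^ i"
      unfolding power_add power_mult[of _ m] radical hom_power by (rule mult.commute)
    finally show "(\<iota> (h i) * \<eta> ^ i) ^ ?P = \<iota> (h i ^ ?P * g ^ (i * t)) * \<eta> ^ i"
      by (simp add: power_mult_distrib hom_mult hom_power)
  qed simp
  finally show ?thesis .
qed

text \<open>The bounded quantity is v of the m-th power of h_i \<eta>^i, so each single term is
  integral over v. A negative quantity would be multiplied by P, while the coefficients of the P-th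
  power keep values at least B.\<close>

lemma coefficient_bound:
  assumes char: "prime CHAR('f)" "coprime CHAR('f) m"
    and independent: "\<And>h k. combination h = combination k \<Longrightarrow> \<forall>i<m. h i = k i"
    and v: "v \<in> base_valuations"
    and all: "\<And>R. valuation_ring constants R \<Longrightarrow> lies_over R v \<Longrightarrow> combination h \<in> R"
    and g: "g \<noteq> 0" and i: "i < m" "h i \<noteq> 0"
  shows "0 \<le> int m * v (h i) + int i * v g"
proof (rule ccontr)
  assume neg: "\<not> 0 \<le> int m * v (h i) + int i * v g"
  interpret v: discrete_valuation v by (rule discrete_valuation_base[OF v])
  obtain n c where nc: "\<And>i. c i = 0 \<or> 0 \<le> v (c i)"
    "combination h ^ n = (\<Sum>i<n. \<iota> (c i) * combination h ^ i)"
    using integral_if_in_all_valuation_rings[OF v all] by metis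
  obtain B where B: "\<And>k. \<exists>h'. combination h ^ k = combination h' \<and> (\<forall>i<m. h' i = 0 \<or> B \<le> v (h' i))"
    using integral_powers_bounded[OF discrete_valuation_base[OF v] nc] by blast
  \<comment> \<open>Chosen so that the power P of the characteristic, at least 2^k > k \<ge> b,
    exceeds |i v(g) + m B|; the factor d of k makes P congruent to 1 modulo m.\<close>
  define b where "b = nat \<bar>int i * v g + int m * B\<bar> + 1"
  obtain d where d: "d > 0" "[CHAR('f) ^ d = 1] (mod m)"
    using exists_power_cong_one[OF char(2) m_pos] by blast
  define k where "k = d * b"
  let ?P = "CHAR('f) ^ k"

  have "[?P = 1 ^ b] (mod m)"
    unfolding k_def power_mult by (intro cong_pow d)
  then have "[?P = 1] (mod m)" by simp
  moreover have ge: "1 \<le> ?P" using char prime_gt_0_nat by (simp add: Suc_leI)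
  ultimately obtain t where "?P = t * m + 1" using cong_le_nat[of 1 ?P m] by blast
  then have t: "?P = 1 + m * t" by simp
  have large: "int ?P > \<bar>int i * v g + int m * B\<bar>"
  proof -
    have "b \<le> k" using d by (simp add: k_def)
    also have "k < 2 ^ k" by (rule less_exp)
    also have "\<dots> \<le> ?P" using prime_ge_2_nat[OF char(1)] by (rule power_mono) simp
    finally show ?thesis unfolding b_def by linarith
  qed
  obtain h' where h': "combination h ^ ?P = combination h'" "\<forall>i<m. h' i = 0 \<or> B \<le> v (h' i)"
    using B by blast
  from h'(1)[symmetric] have "combination h' = combination (\<lambda>i. h i ^ ?P * g ^ (i * t))"
    unfolding frobenius_combination[OF char(1) t] .
  from independent[OF this] have "h' i = h i ^ ?P * g ^ (i * t)" using i by blast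
  then have "B \<le> v (h i ^ ?P * g ^ (i * t))" using h'(2) i g by auto
  also have "\<dots> = int ?P * v (h i) + int i * int t * v g"
    using i g by (simp add: v.val_mult v.val_power)
  finally have "int m * B \<le> int m * (int ?P * v (h i) + int i * int t * v g)"
    by (rule mult_left_mono) simp
  \<comment> \<open>Uses m t = P - 1. The bracket is a negative integer, hence at most -1, and the
    comparison with m B contradicts the size of P.\<close>
  also have "\<dots> = int ?P * (int m * v (h i) + int i * v g) - int i * v g"
    unfolding t by (simp add: algebra_simps)
  also have "\<dots> \<le> int ?P * (- 1) - int i * v g"
    using neg by (intro diff_right_mono mult_left_mono) auto
  finally show False using large by linarith
qed

end

section \<open>The degree formula\<close>

definition index_valuation :: "(nat \<Rightarrow> 'k::field poly) \<Rightarrow> nat \<Rightarrow> 'k poly fract \<Rightarrow> int" where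
  "index_valuation p k = (if k = 0 then vinf else vfin (p k))"

locale distinct_primes =
  fixes r :: nat and p :: "nat \<Rightarrow> 'k::field poly"
  assumes monic: "i \<in> {1..r} \<Longrightarrow> lead_coeff (p i) = 1"
    and irreducible: "i \<in> {1..r} \<Longrightarrow> irreducible (p i)"
    and distinct: "inj_on p {1..r}"
begin

lemma index_valuation_base: "k \<le> r \<Longrightarrow> index_valuation p k \<in> base_valuations"
  using monic irreducible by (auto simp: index_valuation_def base_valuations_def)

definition prime_product :: "(nat \<Rightarrow> int) \<Rightarrow> 'k poly fract" where
  "prime_product b = (\<Prod>i=1..r. to_fract (p i) powi b i)"

lemma prime_nonzero: "i \<in> {1..r} \<Longrightarrow> p i \<noteq> 0"
  using irreducible[of i] by (auto simp: irreducible_def)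

lemma prime_product_nonzero: "prime_product b \<noteq> 0"
  using prime_nonzero by (auto simp: prime_product_def)

lemma val_prime_product:
  assumes "discrete_valuation v"
  shows "v (prime_product b) = (\<Sum>i=1..r. b i * v (to_fract (p i)))"
proof -
  interpret v: discrete_valuation v by (rule assms)
  show ?thesis
    unfolding prime_product_def using prime_nonzero
    by (subst v.val_prod) (auto simp: v.val_power_int intro!: sum.cong)
qed

lemma vfin_prime_product_other:
  assumes "irreducible q" "lead_coeff q = 1" "q \<notin> p ` {1..r}"
  shows "vfin q (prime_product b) = 0"
proof -
  note prime = field_poly_irreducible_imp_prime[OF assms(1)]
  have "vfin q (to_fract (p i)) = 0" if "i \<in> {1..r}" for i
  proof (rule vfin_to_fract[OF prime])
    have "q \<noteq> p i" using assms(3) that by blast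
    then show "\<not> q dvd p i"
      by (rule monic_irreducible_not_dvd[OF assms(1) irreducible[OF that] assms(2) monic[OF that]])
  qed
  then show ?thesis using val_prime_product[OF discrete_valuation_vfin[OF prime]] by simp
qed

lemma vfin_prime_product:
  assumes k: "k \<in> {1..r}"
  shows "vfin (p k) (prime_product b) = b k"
proof -
  note prime = field_poly_irreducible_imp_prime[OF irreducible[OF k]]
  have "vfin (p k) (to_fract (p i)) = (if i = k then 1 else 0)" if i: "i \<in> {1..r}" for i
  proof (cases "i = k")
    case False
    then have "p k \<noteq> p i" using distinct i k by (auto dest: inj_onD)
    then show ?thesis
      using False monic_irreducible_not_dvd[OF irreducible[OF k] irreducible[OF i] monic[OF k] monic[OF i]]
      by (simp add: vfin_to_fract[OF prime])
  qed (simp add: vfin_to_fract_self[OF prime])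
  then have "(\<Sum>i=1..r. b i * vfin (p k) (to_fract (p i))) = (\<Sum>i=1..r. if i = k then b i else 0)"
    by (intro sum.cong) auto
  then show ?thesis using val_prime_product[OF discrete_valuation_vfin[OF prime]] k by simp
qed

lemma vinf_prime_product: "vinf (prime_product b) = - (\<Sum>i=1..r. b i * int (degree (p i)))"
proof -
  have "(\<Sum>i=1..r. b i * vinf (to_fract (p i))) = (\<Sum>i=1..r. - (b i * int (degree (p i))))"
    using prime_nonzero by (intro sum.cong) (auto simp: vinf_to_fract)
  then show ?thesis
    using val_prime_product[OF discrete_valuation_vinf] by (simp add: sum_negf)
qed

lemma base_valuation_cases:
  assumes "v \<in> base_valuations"
  obtains k where "k \<le> r" "v = index_valuation p k"
  | q where "irreducible q" "lead_coeff q = 1" "q \<notin> p ` {1..r}" "v = vfin q"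
proof -
  consider "v = vinf" | q where "v = vfin q" "irreducible q" "lead_coeff q = 1"
    using assms by (auto simp: base_valuations_def)
  then show thesis
  proof cases
    case 1
    then show ?thesis using that(1)[of 0] by (simp add: index_valuation_def)
  next
    case 2
    show ?thesis
    proof (cases "q \<in> p ` {1..r}")
      case True
      then obtain k where "k \<in> {1..r}" "q = p k" by blast
      then show ?thesis using that(1)[of k] 2 by (simp add: index_valuation_def)
    next
      case False
      then show ?thesis using that(2)[of q] 2 by simp
    qed
  qed
qed

text \<open>Dividing h by the product of the p_k with the same values leaves an element without
  finite poles. Possible zeros of h at other places turn the degree formula into an
  inequality.\<close>

lemma degree_inequality:
  assumes h: "h \<noteq> 0"
    and nonneg: "\<And>v. v \<in> base_valuations \<Longrightarrow> v \<notin> index_valuation p ` {0..r} \<Longrightarrow> 0 \<le> v h"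
  shows "(\<Sum>k=0..r. index_valuation p k h * int (kummer_deg p k)) \<le> 0"
proof -
  interpret inf: discrete_valuation "vinf :: 'k poly fract \<Rightarrow> int" by (rule discrete_valuation_vinf)
  define u where "u = prime_product (\<lambda>k. vfin (p k) h)"
  have u: "u \<noteq> 0" by (simp add: u_def prime_product_nonzero)
  have "vinf (h / u) \<le> 0"
  proof (rule vinf_nonpos_if_vfin_nonneg)
    show "h / u \<noteq> 0" using h u by simp
    fix q :: "'k poly" assume q: "irreducible q" "lead_coeff q = 1"
    interpret q: discrete_valuation "vfin q"
      by (rule discrete_valuation_vfin[OF field_poly_irreducible_imp_prime[OF q(1)]])
    show "0 \<le> vfin q (h / u)"
    proof (cases "q \<in> p ` {1..r}")
      case True
      then show ?thesis using h u vfin_prime_product by (auto simp: q.val_divide u_def)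
    next
      case False
      have base: "vfin q \<in> base_valuations" using q by (auto simp: base_valuations_def)
      have "0 \<le> vfin q h"
      proof (cases "vfin q \<in> index_valuation p ` {0..r}")
        case True
        then obtain k where k: "k \<le> r" "vfin q = index_valuation p k" by auto
        \<comment> \<open>Valuations are compared as functions; the test element q has value 1 at q
          and value at most 0 at every listed one.\<close>
        have "vfin q (to_fract q) = 1"
          by (rule vfin_to_fract_self[OF field_poly_irreducible_imp_prime[OF q(1)]])
        moreover have "vinf (to_fract q) \<le> 0" using q by (subst vinf_to_fract) auto
        moreover have "vfin (p k) (to_fract q) = 0" if "k \<noteq> 0"
        proof -
          have k': "k \<in> {1..r}" using k that by simp
          then have "p k \<noteq> q" using False by blast
          then have "\<not> p k dvd q"
            by (rule monic_irreducible_not_dvd[OF irreducible[OF k'] q(1) monic[OF k'] q(2)])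
          then show ?thesis
            by (rule vfin_to_fract[OF field_poly_irreducible_imp_prime[OF irreducible[OF k']]])
        qed
        ultimately have False using k by (auto simp: index_valuation_def split: if_splits)
        then show ?thesis ..
      qed (use nonneg base in blast)
      then show ?thesis
        using h u vfin_prime_product_other[OF q False] by (simp add: q.val_divide u_def)
    qed
  qed
  then have "vinf h + (\<Sum>k=1..r. vfin (p k) h * int (degree (p k))) \<le> 0"
    using h u by (simp add: inf.val_divide u_def vinf_prime_product)
  moreover have "(\<Sum>k=0..r. index_valuation p k h * int (kummer_deg p k))
      = vinf h + (\<Sum>k=1..r. vfin (p k) h * int (degree (p k)))"
    by (simp add: sum.atLeast_Suc_atMost index_valuation_def kummer_deg_def)
  ultimately show ?thesis by simp
qed

text \<open>The witness is x if s = 0 and 1 / p_s otherwise. Seen in F, its pole divisor is m Q_s,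
  which accounts for the generator m.\<close>

lemma exists_simple_pole:
  assumes s: "s \<le> r" "kummer_deg p s = 1"
  shows "\<exists>h. h \<noteq> 0 \<and> index_valuation p s h = - 1 \<and>
    (\<forall>v\<in>base_valuations. v \<noteq> index_valuation p s \<longrightarrow> 0 \<le> v h)"
proof (cases "s = 0")
  case True
  let ?x = "[:0, 1:] :: 'k poly"
  have "0 \<le> vfin q (to_fract ?x)" if q: "irreducible q" for q
  proof -
    note prime = field_poly_irreducible_imp_prime[OF q]
    interpret q: discrete_valuation "vfin q" by (rule discrete_valuation_vfin[OF prime])
    obtain n b where b: "?x = q ^ n * b" "\<not> q dvd b" using dvd_decompose[OF prime, of ?x] by auto
    then have "b \<noteq> 0" "q \<noteq> 0" using q by auto
    then have "vfin q (to_fract ?x) = int n"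
      unfolding b(1) to_fract_mult to_fract_power
      by (simp add: q.val_mult q.val_power vfin_to_fract_self[OF prime] vfin_to_fract[OF prime b(2)])
    then show ?thesis by simp
  qed
  then show ?thesis
    using True by (intro exI[of _ "to_fract ?x"])
      (auto simp: index_valuation_def base_valuations_def vinf_to_fract)
next
  case False
  then have s': "s \<in> {1..r}" "degree (p s) = 1" using s by (auto simp: kummer_deg_def)
  let ?h = "prime_product (\<lambda>k. if k = s then - 1 else 0)"
  have "0 \<le> v ?h" if v: "v \<in> base_valuations" "v \<noteq> index_valuation p s" for v
    using v(1)
  proof (cases rule: base_valuation_cases)
    case (1 k)
    then have "k \<noteq> s" using v by auto
    have "(\<Sum>i=1..r. (if i = s then - 1 else 0) * int (degree (p i)))
        = (\<Sum>i=1..r. if i = s then - 1 else 0)"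
      using s' by (intro sum.cong) auto
    then have "vinf ?h = 1" using s' by (simp add: vinf_prime_product)
    then show ?thesis using 1 \<open>k \<noteq> s\<close> by (auto simp: index_valuation_def vfin_prime_product)
  qed (simp add: vfin_prime_product_other)
  moreover have "index_valuation p s ?h = - 1"
    using s' False by (simp add: index_valuation_def vfin_prime_product)
  ultimately show ?thesis using prime_product_nonzero by blast
qed

end


section \<open>Weierstrass semigroups at totally ramified places\<close>

context radical_function_field
begin



text \<open>From m \<nu>(\<eta>) = e v(g) and coprimality, m divides e, say e = m e'. The terms of a
  combination have values e' (m v(h_i) + i v(g)), which are distinct because the i v(g) are distinct
  modulo m. So e' divides every value, and surjectivity of the normalized valuation gives e' = 1,
  without an appeal to e \<le> [F : K(x)].\<close>

lemma totally_ramified: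
  assumes R: "valuation_ring constants R" and v: "discrete_valuation v"
    and over: "lies_over R v"
    and g: "g \<noteq> 0" "coprime (int m) (v g)"
  defines "\<nu> \<equiv> place_val (R - ring_units R)"
  shows "discrete_valuation \<nu>" "R = {z. z = 0 \<or> 0 \<le> \<nu> z}"
    "i < m \<Longrightarrow> h i \<noteq> 0 \<Longrightarrow> combination h \<noteq> 0 \<and>
      (\<exists>i<m. h i \<noteq> 0 \<and> \<nu> (combination h) = int m * v (h i) + int i * v g \<and>
        (\<forall>j<m. h j \<noteq> 0 \<longrightarrow> int m * v (h i) + int i * v g \<le> int m * v (h j) + int j * v g))"
proof -
  obtain e where e: "e > 0" "discrete_valuation \<nu>" "R = {z. z = 0 \<or> 0 \<le> \<nu> z}"
    "\<forall>a. a \<noteq> 0 \<longrightarrow> \<nu> (\<iota> a) = e * v a"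
    unfolding \<nu>_def by (rule place_over[OF R v over])
  interpret \<nu>: discrete_valuation \<nu> by (rule e(2))
  have \<eta>: "\<eta> \<noteq> 0" using radical g m_pos by (metis hom_eq_0_iff power_eq_0_iff)
  have m\<eta>: "int m * \<nu> \<eta> = e * v g" using e(4) g \<nu>.val_power[OF \<eta>, of m] by (simp add: radical)
  then have "int m dvd e * v g" by (metis dvd_triv_left)
  then have "int m dvd e" using g(2) by (simp add: coprime_dvd_mult_left_iff)
  then obtain e' where e': "e = int m * e'" by blast
  have e'_pos: "e' > 0" using e(1) m_pos unfolding e' by (simp add: zero_less_mult_iff)
  have "\<nu> \<eta> = e' * v g" using m\<eta> m_pos by (simp add: e')
  then have val_term: "\<nu> (\<iota> a * \<eta> ^ i) = e' * (int m * v a + int i * v g)" if "a \<noteq> 0" for a i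
    using that \<eta> e(4) by (simp add: \<nu>.val_mult \<nu>.val_power e' algebra_simps)
  have main: "combination h \<noteq> 0 \<and>
    (\<exists>i<m. h i \<noteq> 0 \<and> \<nu> (combination h) = e' * (int m * v (h i) + int i * v g) \<and>
      (\<forall>j<m. h j \<noteq> 0 \<longrightarrow> int m * v (h i) + int i * v g \<le> int m * v (h j) + int j * v g))"
    if i: "i < m" "h i \<noteq> 0" for h i
  proof -
    let ?J = "{j. j < m \<and> h j \<noteq> 0}"
    let ?f = "\<lambda>j. \<iota> (h j) * \<eta> ^ j"
    have sum: "combination h = sum ?f ?J"
      unfolding combination_def by (rule sum.mono_neutral_right) auto
    have "inj_on (\<lambda>j. \<nu> (?f j)) ?J"
    proof (rule inj_onI)
      fix j k assume jk: "j \<in> ?J" "k \<in> ?J" "\<nu> (?f j) = \<nu> (?f k)"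
      then have "int m * v (h j) + int j * v g = int m * v (h k) + int k * v g"
        using val_term e'_pos by simp
      then have "(int j - int k) * v g = int m * (v (h k) - v (h j))" by (simp add: algebra_simps)
      then have "int m dvd (int j - int k) * v g" by simp
      then have "int m dvd int j - int k" using g(2) by (simp add: coprime_dvd_mult_left_iff)
      moreover have "\<bar>int j - int k\<bar> < int m" using jk by auto
      ultimately have "int j - int k = 0" by (metis abs_of_nat dvd_imp_le_int not_le)
      then show "j = k" by simp
    qed
    then have "sum ?f ?J \<noteq> 0 \<and> (\<exists>i\<in>?J. \<nu> (sum ?f ?J) = \<nu> (?f i) \<and> (\<forall>j\<in>?J. \<nu> (?f i) \<le> \<nu> (?f j)))"
      using i \<eta> by (intro \<nu>.val_sum_distinct) auto
    then obtain k where k: "sum ?f ?J \<noteq> 0" "k \<in> ?J" "\<nu> (sum ?f ?J) = \<nu> (?f k)"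
      "\<And>j. j \<in> ?J \<Longrightarrow> \<nu> (?f k) \<le> \<nu> (?f j)" by blast
    have "int m * v (h k) + int k * v g \<le> int m * v (h j) + int j * v g" if "j < m" "h j \<noteq> 0" for j
      using k(4)[of j] k(2) that val_term e'_pos by simp
    then show ?thesis unfolding sum using k(1,2,3) val_term by auto
  qed
  have "e' = 1"
  proof -
    obtain t where t: "t \<noteq> 0" "\<nu> t = 1" using \<nu>.val_uniformizer by blast
    obtain h where h: "t = combination h" using combination_surj by blast
    have "\<exists>i<m. h i \<noteq> 0"
    proof (rule ccontr)
      assume "\<not> ?thesis"
      then have "t = 0" unfolding h combination_def by (intro sum.neutral) auto
      then show False using t by simp
    qed
    then obtain x where "1 = e' * x" using main t h by metis
    then have "e' dvd 1" by (metis dvd_triv_left)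
    then show ?thesis using e'_pos by simp
  qed
  then show "i < m \<Longrightarrow> h i \<noteq> 0 \<Longrightarrow> combination h \<noteq> 0 \<and>
      (\<exists>i<m. h i \<noteq> 0 \<and> \<nu> (combination h) = int m * v (h i) + int i * v g \<and>
        (\<forall>j<m. h j \<noteq> 0 \<longrightarrow> int m * v (h i) + int i * v g \<le> int m * v (h j) + int j * v g))"
    using main by simp
  show "discrete_valuation \<nu>" "R = {z. z = 0 \<or> 0 \<le> \<nu> z}" by (rule e(2), rule e(3))
qed

lemma nonzero_coefficient: "combination h \<noteq> 0 \<Longrightarrow> \<exists>i<m. h i \<noteq> 0"
  unfolding combination_def by (metis (no_types, lifting) hom_zero lessThan_iff mult_zero_left sum.neutral)

text \<open>The value of a combination is the minimum of m v(h_i) + i v(g) over its nonzero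
  coefficients, which does not depend on the ring above v.\<close>

lemma unique_place_over:
  assumes "valuation_ring constants R" "valuation_ring constants R'" and v: "discrete_valuation v"
    and over: "lies_over R v" "lies_over R' v"
    and g: "g \<noteq> 0" "coprime (int m) (v g)"
  shows "R = R'"
proof (rule set_eqI)
  fix z
  note tot = totally_ramified[OF assms(1) v over(1) g] totally_ramified[OF assms(2) v over(2) g]
  show "z \<in> R \<longleftrightarrow> z \<in> R'"
  proof (cases "z = 0")
    case True
    then show ?thesis using assms(1,2) by (simp add: valuation_ring_zero)
  next
    case False
    obtain h where h: "z = combination h" using combination_surj by blast
    then obtain i where i: "i < m" "h i \<noteq> 0" using nonzero_coefficient False by blast
    have "place_val (R - ring_units R) z = place_val (R' - ring_units R') z"
      using tot(3)[of i h] tot(6)[of i h] i unfolding h by (metis order_antisym)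
    moreover have "z \<in> R \<longleftrightarrow> 0 \<le> place_val (R - ring_units R) z" using tot(2) False by blast
    moreover have "z \<in> R' \<longleftrightarrow> 0 \<le> place_val (R' - ring_units R') z" using tot(5) False by blast
    ultimately show ?thesis by simp
  qed
qed

lemma place_val_nonneg_iff:
  assumes R: "valuation_ring constants R" and "z \<noteq> 0"
  shows "0 \<le> place_val (R - ring_units R) z \<longleftrightarrow> z \<in> R"
proof -
  obtain v where v: "v \<in> base_valuations" "lies_over R v"
    using lies_over_base_valuation[OF R] by blast
  obtain e where "R = {z. z = 0 \<or> 0 \<le> place_val (R - ring_units R) z}"
    by (rule place_over[OF R discrete_valuation_base[OF v(1)] v(2)])
  then show ?thesis using assms(2) by blast
qed

lemma weierstrass_semigroup_iff:
  assumes R: "valuation_ring constants R" and \<nu>1: "place_val (R - ring_units R) 1 = 0"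
  shows "n \<in> weierstrass_semigroup constants (R - ring_units R) \<longleftrightarrow>
    (\<exists>z. z \<noteq> 0 \<and> place_val (R - ring_units R) z = - int n \<and>
      (\<forall>R'. valuation_ring constants R' \<longrightarrow> R' \<noteq> R \<longrightarrow> z \<in> R'))"
    (is "_ \<longleftrightarrow> (\<exists>z. ?A z)")
proof
  let ?Q = "R - ring_units R"
  have Q: "is_place constants ?Q" using R by (auto simp: is_place_def)
  have other: "R' - ring_units R' \<noteq> ?Q" if "valuation_ring constants R'" "R' \<noteq> R" for R'
    using place_ring_eq[OF R] place_ring_eq[OF that(1)] that(2) by metis
  {
    assume "n \<in> weierstrass_semigroup constants ?Q"
    then obtain z where z: "z \<noteq> 0" "pole_divisor constants z = (\<lambda>P. if P = ?Q then int n else 0)"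
      unfolding weierstrass_semigroup_def by blast
    show "\<exists>z. ?A z"
    proof (cases "n = 0")
      \<comment> \<open>A vanishing pole divisor only says that z has nonnegative value at the
        place; 1 has value exactly 0.\<close>
      case True
      then show ?thesis using \<nu>1 by (intro exI[of _ 1]) (auto intro: valuation_ring_one)
    next
      case False
      have "pole_divisor constants z ?Q = int n" using z(2) by simp
      then have "place_val ?Q z = - int n"
        using False Q by (auto simp: pole_divisor_def split: if_splits)
      moreover have "z \<in> R'" if R': "valuation_ring constants R'" "R' \<noteq> R" for R'
      proof -
        have "pole_divisor constants z (R' - ring_units R') = 0" using z(2) other[OF R'] by simp
        moreover have "is_place constants (R' - ring_units R')" using R' by (auto simp: is_place_def)
        ultimately have "0 \<le> place_val (R' - ring_units R') z"
          by (auto simp: pole_divisor_def split: if_splits)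
        then show ?thesis using place_val_nonneg_iff[OF R'(1) z(1)] by simp
      qed
      ultimately show ?thesis using z(1) by blast
    qed
  next
    assume "\<exists>z. ?A z"
    then obtain z where z: "?A z" by blast
    have "pole_divisor constants z P = (if P = ?Q then int n else 0)" for P
    proof (cases "P = ?Q")
      case True
      then show ?thesis using z Q by (simp add: pole_divisor_def)
    next
      case False
      have "0 \<le> place_val P z" if "is_place constants P"
      proof -
        obtain R' where R': "valuation_ring constants R'" "P = R' - ring_units R'"
          using \<open>is_place constants P\<close> unfolding is_place_def by blast
        then show ?thesis using z False place_val_nonneg_iff[OF R'(1)] by auto
      qed
      then show ?thesis using False by (auto simp: pole_divisor_def)
    qed
    then show "n \<in> weierstrass_semigroup constants ?Q"
      using z unfolding weierstrass_semigroup_def by blast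
  }
qed

end

lemma multiple_in_submonoid:
  fixes a :: int
  assumes "a \<in> A"
  shows "a * int k \<in> submonoid_generated A"
proof (induction k)
  case 0
  show ?case by (simp add: submonoid_generated.zero)
next
  case (Suc k)
  have "a + a * int k \<in> submonoid_generated A"
    by (rule submonoid_generated.add[OF submonoid_generated.incl[OF assms] Suc])
  then show ?case by (simp add: algebra_simps)
qed

section \<open>The semigroup in terms of the radical \<eta> and its power g\<close>

locale ramified_radical_extension =
  radical_function_field \<iota> m g \<eta> + distinct_primes r p
  for \<iota> :: "'k::field poly fract \<Rightarrow> 'f::field" and m g \<eta> r and p :: "nat \<Rightarrow> 'k poly" +
  fixes s :: nat and R :: "'f set"
  assumes s_le: "s \<le> r" and degree_s: "kummer_deg p s = 1"
    and R: "valuation_ring constants R" and R_over: "lies_over R (index_valuation p s)"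
    and g_nonzero: "g \<noteq> 0"
    and g_s: "[index_valuation p s g = - 1] (mod int m)"
    and g_other: "v \<in> base_valuations \<Longrightarrow> v \<notin> index_valuation p ` {0..r} \<Longrightarrow> v g = 0"
    and char: "prime CHAR('f)" "coprime CHAR('f) m"
begin

abbreviation "V \<equiv> index_valuation p"
abbreviation "\<nu> \<equiv> place_val (R - ring_units R)"

text \<open>The least value of h at the k-th place for which h \<eta>^i is regular above it, see
  \<open>ceiling_bound_le_iff\<close>. For g = f^-\<mu> it is the ceiling in the theorem.\<close>

definition ceiling_bound :: "nat \<Rightarrow> nat \<Rightarrow> int" where
  "ceiling_bound i k = \<lceil>real_of_int (- (int i * V k g)) / real m\<rceil>"

text \<open>An integer, to match the theorem; for 1 \<le> i < m it turns out to be the pole order of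
  an extremal term of index i and thereby nonnegative.\<close>

definition generator :: "nat \<Rightarrow> int" where
  "generator i = int m * ((\<Sum>k=0..r. ceiling_bound i k * int (kummer_deg p k)) - 1) + int i"

lemma ceiling_bound_le_iff: "ceiling_bound i k \<le> x \<longleftrightarrow> 0 \<le> int m * x + int i * V k g"
proof -
  have "ceiling_bound i k \<le> x \<longleftrightarrow> real_of_int (- (int i * V k g)) \<le> real_of_int (x * int m)"
    unfolding ceiling_bound_def ceiling_le_iff using m_pos
    by (simp only: pos_divide_le_eq of_nat_0_less_iff of_int_mult[of x] of_int_of_nat_eq)
  also have "\<dots> \<longleftrightarrow> - (int i * V k g) \<le> x * int m" by (rule of_int_le_iff)
  also have "\<dots> \<longleftrightarrow> 0 \<le> int m * x + int i * V k g" by (auto simp: algebra_simps)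
  finally show ?thesis .
qed

lemma discrete_valuation_V: "k \<le> r \<Longrightarrow> discrete_valuation (V k)"
  by (intro discrete_valuation_base index_valuation_base)

lemma coprime_g: "coprime (int m) (V s g)"
proof -
  have "coprime (- 1) (int m)" by simp
  then have "coprime (V s g) (int m)" using cong_imp_coprime[OF cong_sym[OF g_s]] by simp
  then show ?thesis by (simp add: coprime_commute)
qed

lemmas ramified = totally_ramified[OF R discrete_valuation_V[OF s_le] R_over g_nonzero coprime_g]

sublocale \<nu>: discrete_valuation \<nu>
  by (rule ramified(1))

lemma val_monomial:
  assumes "i < m" "h \<noteq> 0"
  shows "\<iota> h * \<eta> ^ i \<noteq> 0" "\<nu> (\<iota> h * \<eta> ^ i) = int m * V s h + int i * V s g"
proof -
  let ?h = "\<lambda>j. if j = i then h else 0"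
  have "combination ?h \<noteq> 0 \<and> (\<exists>j<m. ?h j \<noteq> 0 \<and>
      \<nu> (combination ?h) = int m * V s (?h j) + int j * V s g \<and>
      (\<forall>k<m. ?h k \<noteq> 0 \<longrightarrow> int m * V s (?h j) + int j * V s g \<le> int m * V s (?h k) + int k * V s g))"
    by (rule ramified(3)[of i]) (use assms in simp_all)
  then show "\<iota> h * \<eta> ^ i \<noteq> 0" "\<nu> (\<iota> h * \<eta> ^ i) = int m * V s h + int i * V s g"
    using combination_monomial[OF assms(1), of h] by (auto split: if_splits)
qed

text \<open>A combination with a nonzero coefficient has a dominating term at the place above s, so
  it cannot vanish; this is applied to the difference.\<close>

lemma independent:
  assumes "combination h = combination k"
  shows "\<forall>i<m. h i = k i"
proof (rule ccontr)
  assume "\<not> ?thesis"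
  then obtain i where i: "i < m" "h i + - 1 * k i \<noteq> 0" by auto
  have "combination (\<lambda>i. h i + - 1 * k i) = combination h + \<iota> (- 1) * combination k"
    unfolding combination_scale combination_add ..
  also have "\<dots> = 0" using assms by (simp add: hom_uminus)
  finally show False using ramified(3)[of i "\<lambda>i. h i + - 1 * k i"] i by simp
qed

lemma lies_over_unique: "valuation_ring constants R' \<Longrightarrow> lies_over R' (V s) \<Longrightarrow> R' = R"
  using unique_place_over[OF _ R discrete_valuation_V[OF s_le] _ R_over g_nonzero coprime_g] by blast

lemma lies_over_other:
  assumes "v \<in> base_valuations" "v \<noteq> V s" "lies_over R' v"
  shows "R' \<noteq> R"
proof
  assume "R' = R"
  obtain h where "h \<noteq> 0" "V s h > 0" "v h < 0"
    using base_valuations_separated[OF index_valuation_base[OF s_le] assms(1)] assms(2) by metis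
  then show False using R_over assms(3) \<open>R' = R\<close> unfolding lies_over_def by fastforce
qed

definition pole_numbers :: "nat set" where
  "pole_numbers = weierstrass_semigroup constants (R - ring_units R)"

lemma pole_numbers_iff:
  "n \<in> pole_numbers \<longleftrightarrow> (\<exists>z. z \<noteq> 0 \<and> \<nu> z = - int n \<and>
    (\<forall>R'. valuation_ring constants R' \<longrightarrow> R' \<noteq> R \<longrightarrow> z \<in> R'))"
  unfolding pole_numbers_def by (rule weierstrass_semigroup_iff[OF R \<nu>.val_one])

lemma zero_pole_number: "0 \<in> pole_numbers"
  unfolding pole_numbers_iff by (intro exI[of _ 1]) (auto intro: valuation_ring_one)

lemma add_pole_numbers:
  assumes "a \<in> pole_numbers" "b \<in> pole_numbers"
  shows "a + b \<in> pole_numbers"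
proof -
  obtain y z where "y \<noteq> 0" "\<nu> y = - int a" "\<forall>R'. valuation_ring constants R' \<longrightarrow> R' \<noteq> R \<longrightarrow> y \<in> R'"
    "z \<noteq> 0" "\<nu> z = - int b" "\<forall>R'. valuation_ring constants R' \<longrightarrow> R' \<noteq> R \<longrightarrow> z \<in> R'"
    using assms unfolding pole_numbers_iff by blast
  then show ?thesis unfolding pole_numbers_iff
    by (intro exI[of _ "y * z"]) (auto simp: \<nu>.val_mult intro: valuation_ringD(5))
qed

text \<open>The m-th power of the term lies in K(x) and has nonnegative value below R', and
  valuation rings are closed under m-th roots. Uniqueness of the place above s ensures that R' lies
  over another valuation.\<close>

lemma regular_elsewhere:
  assumes h: "h \<noteq> 0" and i: "i < m"
    and nonneg: "\<And>v. v \<in> base_valuations \<Longrightarrow> v \<noteq> V s \<Longrightarrow> 0 \<le> int m * v h + int i * v g"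
    and R': "valuation_ring constants R'" "R' \<noteq> R"
  shows "\<iota> h * \<eta> ^ i \<in> R'"
proof -
  obtain v where v: "v \<in> base_valuations" "lies_over R' v"
    using lies_over_base_valuation[OF R'(1)] by blast
  interpret v: discrete_valuation v by (rule discrete_valuation_base[OF v(1)])
  have "v \<noteq> V s" using lies_over_unique[OF R'(1)] v R'(2) by blast
  then have "0 \<le> v (h ^ m * g ^ i)"
    using nonneg[OF v(1)] h g_nonzero by (simp add: v.val_mult v.val_power)
  then have "\<iota> (h ^ m * g ^ i) \<in> R'" using v(2) h g_nonzero by (simp add: lies_over_def)
  moreover have "\<iota> (h ^ m * g ^ i) = (\<iota> h * \<eta> ^ i) ^ m"
    by (simp add: hom_mult hom_power power_mult_distrib mult.commute[of i] flip: radical power_mult)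
  ultimately show ?thesis using valuation_ring_power_iff[OF R'(1) m_pos] by simp
qed

lemma m_pole_number: "m \<in> pole_numbers"
proof -
  obtain h where h: "h \<noteq> 0" "V s h = - 1" "\<And>v. v \<in> base_valuations \<Longrightarrow> v \<noteq> V s \<Longrightarrow> 0 \<le> v h"
    using exists_simple_pole[OF s_le degree_s] by blast
  have "\<iota> h * \<eta> ^ 0 \<noteq> 0 \<and> \<nu> (\<iota> h * \<eta> ^ 0) = - int m \<and>
    (\<forall>R'. valuation_ring constants R' \<longrightarrow> R' \<noteq> R \<longrightarrow> \<iota> h * \<eta> ^ 0 \<in> R')"
    using val_monomial[OF m_pos h(1)] h regular_elsewhere[OF h(1) m_pos] by simp
  then show ?thesis unfolding pole_numbers_iff by blast
qed

text \<open>With V s g = -1 + m e and 0 < i < m the ceiling at s is 1 - i e. This 1 cancels the -1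
  of the list entry, which becomes the negated value of h \<eta>^i for V s h = -S, where S is the
  sum over the other places.\<close>

lemma generator_eq:
  assumes i: "i \<in> {1..m - 1}"
  shows "generator i = int m * (\<Sum>k\<in>{0..r} - {s}. ceiling_bound i k * int (kummer_deg p k)) - int i * V s g"
proof -
  obtain e where e: "V s g = - 1 + int m * e"
    using g_s by (metis add.commute cong_iff_lin cong_sym)
  have lt: "int i < int m" "0 < int i" using i by auto
  have "ceiling_bound i s \<le> 1 - int i * e"
    unfolding ceiling_bound_le_iff e using lt by (simp add: algebra_simps)
  moreover have "\<not> ceiling_bound i s \<le> - int i * e"
    unfolding ceiling_bound_le_iff e using lt by (simp add: algebra_simps)
  ultimately have ceiling_bound: "ceiling_bound i s = 1 - int i * e" by simp
  have sum: "(\<Sum>k=0..r. ceiling_bound i k * int (kummer_deg p k))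
      = ceiling_bound i s + (\<Sum>k\<in>{0..r} - {s}. ceiling_bound i k * int (kummer_deg p k))"
    using s_le degree_s by (subst sum.remove[of _ s]) auto
  show ?thesis unfolding generator_def sum ceiling_bound e by (simp add: algebra_simps)
qed

text \<open>The degree inequality solved for the place s, whose degree is 1.\<close>

lemma val_at_s:
  assumes h: "h \<noteq> 0"
    and nonneg: "\<And>v. v \<in> base_valuations \<Longrightarrow> v \<notin> V ` {0..r} \<Longrightarrow> 0 \<le> v h"
    and ge: "\<And>k. k \<le> r \<Longrightarrow> k \<noteq> s \<Longrightarrow> c k \<le> V k h"
  shows "V s h \<le> - (\<Sum>k\<in>{0..r} - {s}. c k * int (kummer_deg p k))"
proof -
  have "(\<Sum>k=0..r. V k h * int (kummer_deg p k)) \<le> 0"    by (rule degree_inequality) (use h nonneg in auto)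
  moreover have "(\<Sum>k=0..r. V k h * int (kummer_deg p k))
      = V s h + (\<Sum>k\<in>{0..r} - {s}. V k h * int (kummer_deg p k))"
    using s_le degree_s by (subst sum.remove[of _ s]) auto
  moreover have "(\<Sum>k\<in>{0..r} - {s}. c k * int (kummer_deg p k))
      \<le> (\<Sum>k\<in>{0..r} - {s}. V k h * int (kummer_deg p k))"
    using ge by (intro sum_mono mult_right_mono) auto
  ultimately show ?thesis by linarith
qed

lemma generator_pole_number:
  assumes i: "i \<in> {1..m - 1}"
  shows "\<exists>n. int n = generator i \<and> n \<in> pole_numbers"
proof -
  define S where "S = (\<Sum>k\<in>{0..r} - {s}. ceiling_bound i k * int (kummer_deg p k))"
  \<comment> \<open>Least admissible values at all places other than s; the value -S at s makes the
    total degree zero, which is equality in \<open>val_at_s\<close>.\<close>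
  define h where "h = prime_product (\<lambda>k. if k = s then - S else ceiling_bound i k)"
  have h: "h \<noteq> 0" by (simp add: h_def prime_product_nonzero)
  have im: "i < m" using i by auto
  have V: "V k h = (if k = s then - S else ceiling_bound i k)" if k: "k \<le> r" for k
  proof (cases "k = 0")
    case False
    then show ?thesis using k by (simp add: index_valuation_def h_def vfin_prime_product)
  next
    \<comment> \<open>Index 0 contributes no factor to the product: the value at infinity is
      determined by the finite ones and comes out right because the prescribed values have total
      degree zero.\<close>
    case True
    have deg: "kummer_deg p j = degree (p j)" if "j \<noteq> 0" for j using that by (simp add: kummer_deg_def)
    have "V 0 h = - (\<Sum>j=1..r. (if j = s then - S else ceiling_bound i j) * int (degree (p j)))"
      by (simp add: index_valuation_def h_def vinf_prime_product)
    also have "\<dots> = (if 0 = s then - S else ceiling_bound i 0)"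
    proof (cases "s = 0")
      case True
      have "(\<Sum>j=1..r. (if j = s then - S else ceiling_bound i j) * int (degree (p j))) = S"
        unfolding S_def by (rule sum.cong) (use True deg in auto)
      then show ?thesis using True by simp
    next
      case False
      then have s: "s \<in> {1..r}" "degree (p s) = 1" using s_le degree_s deg[of s] by auto
      let ?T = "\<Sum>j\<in>{1..r} - {s}. ceiling_bound i j * int (degree (p j))"
      have "(\<Sum>j=1..r. (if j = s then - S else ceiling_bound i j) * int (degree (p j))) = - S + ?T"
        using s by (subst sum.remove[of _ s]) auto
      moreover have "S = ceiling_bound i 0 + ?T"
      proof -
        have "S = ceiling_bound i 0 * int (kummer_deg p 0)
            + (\<Sum>k\<in>{0..r} - {s} - {0}. ceiling_bound i k * int (kummer_deg p k))"
          unfolding S_def using False by (subst sum.remove[of _ 0]) auto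
        also have "(\<Sum>k\<in>{0..r} - {s} - {0}. ceiling_bound i k * int (kummer_deg p k)) = ?T"
          by (rule sum.cong) (use deg in auto)
        finally show ?thesis by (simp add: kummer_deg_def)
      qed
      ultimately show ?thesis using False by simp
    qed
    finally show ?thesis using True by simp
  qed
  have h_other: "v h = 0" if "v \<in> base_valuations" "v \<notin> V ` {0..r}" for v
    using that(1)
  proof (cases rule: base_valuation_cases)
    case (1 k)
    then show ?thesis using that(2) by auto
  next
    case (2 q)
    then show ?thesis using vfin_prime_product_other by (simp add: h_def)
  qed
  have nonneg: "0 \<le> int m * v h + int i * v g" if v: "v \<in> base_valuations" "v \<noteq> V s" for v
  proof (cases "v \<in> V ` {0..r}")
    case True
    then obtain k where k: "k \<le> r" "v = V k" by auto
    then have "k \<noteq> s" using v by blast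
    then show ?thesis using V[OF k(1)] ceiling_bound_le_iff[of i k "ceiling_bound i k"] k by simp
  next
    case False
    then show ?thesis using h_other[OF v(1)] g_other[OF v(1)] by simp
  qed
  have val: "\<nu> (\<iota> h * \<eta> ^ i) = - generator i"
    using val_monomial(2)[OF im h] V[OF s_le] generator_eq[OF i] by (simp add: S_def)
  \<comment> \<open>An element of K(x) regular outside s has no zero at s. This is applied to (h
    \<eta>^i)^m, whose value at s equals that of h \<eta>^i at the place above s.\<close>
  have "generator i \<ge> 0"
  proof -
    let ?u = "h ^ m * g ^ i"
    have u: "v ?u = int m * v h + int i * v g" if "v \<in> base_valuations" for v
    proof -
      interpret v: discrete_valuation v by (rule discrete_valuation_base[OF that])
      show ?thesis using h g_nonzero by (simp add: v.val_mult v.val_power)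
    qed
    have "V s ?u \<le> - (\<Sum>k\<in>{0..r} - {s}. 0 * int (kummer_deg p k))"
    proof (rule val_at_s)
      show "?u \<noteq> 0" using h g_nonzero by simp
      show "0 \<le> v ?u" if "v \<in> base_valuations" "v \<notin> V ` {0..r}" for v
        using h_other[OF that] g_other[OF that] by (simp add: u[OF that(1)])
      show "0 \<le> V k ?u" if "k \<le> r" "k \<noteq> s" for k
        unfolding u[OF index_valuation_base[OF that(1)]] using V[OF that(1)] that(2)
          ceiling_bound_le_iff[of i k "ceiling_bound i k"] by simp
    qed
    then show ?thesis using val val_monomial(2)[OF im h] u[OF index_valuation_base[OF s_le]] by simp
  qed
  then obtain n where n: "int n = generator i" by (metis nonneg_int_cases)
  have "n \<in> pole_numbers"
    unfolding pole_numbers_iff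
    using val_monomial(1)[OF im h] val n regular_elsewhere[OF h im nonneg]
    by (intro exI[of _ "\<iota> h * \<eta> ^ i"]) auto
  then show ?thesis using n by blast
qed

text \<open>The dominating term at s alone determines the pole order, and it inherits regularity
  elsewhere from the whole sum by \<open>coefficient_bound\<close>. So n is the pole order of a
  single h \<eta>^i, and the slack in the degree inequality contributes a multiple of m.\<close>

lemma pole_number_in_submonoid:
  assumes n: "n \<in> pole_numbers"
  shows "int n \<in> submonoid_generated (insert (int m) {generator i | i. i \<in> {1..m - 1}})" (is "_ \<in> submonoid_generated ?G")
proof -
  obtain z where z: "z \<noteq> 0" "\<nu> z = - int n"
    "\<And>R'. valuation_ring constants R' \<Longrightarrow> R' \<noteq> R \<Longrightarrow> z \<in> R'"
    using n unfolding pole_numbers_iff by blast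
  obtain h where h: "z = combination h" using combination_surj by blast
  obtain j where j: "j < m" "h j \<noteq> 0" using nonzero_coefficient z h by blast
  then obtain i where i: "i < m" "h i \<noteq> 0" "\<nu> z = int m * V s (h i) + int i * V s g"
    using ramified(3)[of j h] unfolding h by blast
  have bound: "0 \<le> int m * v (h i) + int i * v g" if v: "v \<in> base_valuations" "v \<noteq> V s" for v
  proof (rule coefficient_bound[where h = h and i = i and v = v, OF char independent v(1) _ g_nonzero i(1,2)])
    fix R' assume "valuation_ring constants R'" "lies_over R' v"
    then show "combination h \<in> R'" using z(3) lies_over_other[OF v] unfolding h by blast
  qed
  have n_eq: "int n = - (int m * V s (h i)) - int i * V s g" using z(2) i(3) by simp
  have other: "0 \<le> v (h i)" if "v \<in> base_valuations" "v \<notin> V ` {0..r}" for v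
  proof -
    have "v \<noteq> V s" using that s_le by auto
    then have "0 \<le> int m * v (h i)" using bound[OF that(1)] g_other[OF that] by simp
    then show ?thesis using m_pos by (simp add: zero_le_mult_iff)
  qed
  have ge: "ceiling_bound i k \<le> V k (h i)" if "k \<le> r" "V k \<noteq> V s" for k
    unfolding ceiling_bound_le_iff by (rule bound[OF index_valuation_base[OF that(1)] that(2)])
  \<comment> \<open>\<open>bound\<close> excludes v = V s as a function, so distinct indices must be
    shown to give distinct valuations.\<close>
  have V_inj: "V k \<noteq> V s" if "k \<le> r" "k \<noteq> s" for k
  proof
    assume eq: "V k = V s"
    have *: "V a \<noteq> V b" if "a \<in> {1..r}" "b \<le> r" "a \<noteq> b" for a b
    proof
      assume e: "V a = V b"
      let ?u = "prime_product (\<lambda>j. if j = a then 1 else 0)"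
      have "V a ?u = 1" using that by (simp add: index_valuation_def vfin_prime_product)
      moreover have "V b ?u \<le> 0"
        using that by (auto simp: index_valuation_def vfin_prime_product vinf_prime_product intro!: sum_nonneg)
      ultimately show False using e by simp
    qed
    show False using *[of k s] *[of s k] eq that s_le by (cases "k = 0") auto
  qed
  let ?S = "\<Sum>k\<in>{0..r} - {s}. ceiling_bound i k * int (kummer_deg p k)"
  have S: "V s (h i) \<le> - ?S" by (rule val_at_s) (use i(2) other ge V_inj in auto)
  show ?thesis
  proof (cases "i = 0")
    case True
    then have n': "int n = int m * (- V s (h i))" using n_eq by simp
    then have "0 \<le> - V s (h i)" using m_pos by (metis of_nat_0_le_iff of_nat_0_less_iff zero_le_mult_iff not_less)
    then have "int n = int m * int (nat (- V s (h i)))" using n' by (simp only: int_nat_eq) simp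
    moreover have "int m * int (nat (- V s (h i))) \<in> submonoid_generated ?G"
      by (rule multiple_in_submonoid) simp
    ultimately show ?thesis by (simp only:)
  next
    case False
    then have i': "i \<in> {1..m - 1}" using i(1) by auto
    \<comment> \<open>By \<open>S\<close> the difference is nonnegative, so \<open>nat\<close> loses
      nothing.\<close>
    have "int n = generator i + int m * int (nat (- V s (h i) - ?S))"
      using S by (simp add: n_eq generator_eq[OF i'] algebra_simps)
    moreover have "generator i \<in> submonoid_generated ?G" using i' by (intro submonoid_generated.incl) blast
    moreover have "int m * int (nat (- V s (h i) - ?S)) \<in> submonoid_generated ?G"
      by (rule multiple_in_submonoid) simp
    ultimately show ?thesis by (simp only: submonoid_generated.add)
  qed
qed

lemma pole_numbers_eq:
  "int ` pole_numbers = submonoid_generated (insert (int m) {generator i | i. i \<in> {1..m - 1}})"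
proof (intro equalityI subsetI)
  fix x assume "x \<in> submonoid_generated (insert (int m) {generator i | i. i \<in> {1..m - 1}})"
  then show "x \<in> int ` pole_numbers"
  proof induction
    case zero
    show ?case using zero_pole_number by force
  next
    case (incl a)
    then consider "a = int m" | i where "i \<in> {1..m - 1}" "a = generator i" by blast
    then show ?case
      by cases (use m_pole_number generator_pole_number in \<open>blast, metis image_eqI\<close>)
  next
    case (add a b)
    then obtain c d where "a = int c" "b = int d" "c \<in> pole_numbers" "d \<in> pole_numbers" by blast
    then show ?case using add_pole_numbers by (metis image_eqI of_nat_add)
  qed
qed (use pole_number_in_submonoid in blast)

end

section \<open>The Kummer extension\<close>

lemma of_nat_card_subfield:
  fixes k :: "'a::field set"
  assumes "is_subfield k" "finite k"
  shows "of_nat (card k) = (0 :: 'a)"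
proof -
  \<comment> \<open>Translation by 1 permutes k; comparing the sums of x and of x + 1 over k leaves
    card k = 0.\<close>
  have bij: "bij_betw (\<lambda>x. x + 1) k k"
    by (rule bij_betw_byWitness[of _ "\<lambda>x. x + - 1"])
      (use assms(1) in \<open>auto simp: is_subfield_def simp del: add_uminus_conv_diff\<close>)
  have "(\<Sum>x\<in>k. x) = (\<Sum>x\<in>k. x + 1)" using sum.reindex_bij_betw[OF bij, of "\<lambda>x. x"] by simp
  then show ?thesis by (simp add: sum.distrib)
qed

theorem corollary3p8:
  fixes q m r s :: nat
    and \<alpha> :: "'k::field" and p :: "nat \<Rightarrow> 'k poly" and l :: "nat \<Rightarrow> int" and \<mu> :: int
    and \<iota> :: "'k poly fract \<Rightarrow> 'f::field" and y :: 'f and Q :: "'f set"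
  assumes "kummer_extension q m r \<alpha> p l \<iota> y"
    and "s \<le> r"
    and "kummer_deg p s = 1"
    and "gcd (int m) (kummer_exp r p l s) = 1"
    and "[\<mu> * kummer_exp r p l s = 1] (mod int m)"
    and "is_place (range (\<iota> \<circ> const_fract)) Q"
    and "\<iota> ` kummer_base_place p s \<subseteq> Q"
  shows "int ` weierstrass_semigroup (range (\<iota> \<circ> const_fract)) Q =
    submonoid_generated (insert (int m)
      {int m * ((\<Sum>k=0..r. \<lceil>real_of_int (int i * \<mu> * kummer_exp r p l k) / real m\<rceil>
          * int (kummer_deg p k)) - 1) + int i | i. i \<in> {1..m - 1}})"
proof -
  interpret kummer_extension q m r \<alpha> p l \<iota> y by (rule assms(1))
  interpret field_hom \<iota> by standard (fact hom_one hom_add hom_mult)+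
  interpret distinct_primes r p by standard (use monic irreducible distinct in auto)
  define f where "f = kummer_rhs r \<alpha> p l"
  define g where "g = f powi (- \<mu>)"
  define \<eta> where "\<eta> = y powi (- \<mu>)"
  have f_eq: "f = const_fract \<alpha> * prime_product l"
    by (simp add: f_def kummer_rhs_def prime_product_def)
  have const_nonzero: "const_fract \<alpha> \<noteq> 0" using alpha_nonzero by (simp add: const_fract_def)
  then have f: "f \<noteq> 0" unfolding f_eq using prime_product_nonzero by simp
  then have g: "g \<noteq> 0" by (simp add: g_def)
  have y: "y ^ m = \<iota> f" using equation by (simp add: f_def)
  then have y0: "y \<noteq> 0" using f m_ge_2 by (auto simp: power_0_left split: if_splits)
  have eta: "\<eta> ^ m = \<iota> g"
    unfolding g_def \<eta>_def hom_power_int y[symmetric]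
    by (simp flip: power_int_of_nat power_int_mult add: mult.commute)
  \<comment> \<open>\<mu> inverts \<lambda>_s modulo m only; the excess m e is absorbed by y^m = f.
    So y = \<eta>^(-\<lambda>_s) f^(-e), and \<eta> generates the same field.\<close>
  obtain e where e: "\<mu> * kummer_exp r p l s = 1 + int m * e"
    using assms(5) by (metis add.commute cong_iff_lin cong_sym)
  have generator: "generated_field (insert \<eta> (range \<iota>)) = UNIV"
  proof -
    have "insert y (range \<iota>) \<subseteq> S" if S: "is_subfield S" "insert \<eta> (range \<iota>) \<subseteq> S" for S
    proof -
      have pow: "a ^ n \<in> S" if "a \<in> S" for a n
        using that S(1) by (induction n) (auto simp: is_subfield_def)
      have powi: "a powi n \<in> S" if "a \<in> S" for a n
        using pow that S(1) by (auto simp: power_int_def is_subfield_def)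
      have "\<eta> powi (- kummer_exp r p l s) = y powi (\<mu> * kummer_exp r p l s)"
        by (simp add: \<eta>_def flip: power_int_mult)
      also have "\<dots> = y * \<iota> (f powi e)"
        unfolding e using y0
        by (simp add: power_int_add power_int_mult power_int_of_nat hom_power_int y)
      finally have "y = \<eta> powi (- kummer_exp r p l s) * \<iota> (inverse (f powi e))"
        using f by (simp add: hom_inverse)
      moreover have "\<eta> powi (- kummer_exp r p l s) \<in> S" using S(2) by (intro powi) simp
      moreover have "\<iota> (inverse (f powi e)) \<in> S" using S(2) by blast
      ultimately have "y \<in> S" using S(1) unfolding is_subfield_def by metis
      then show ?thesis using S(2) by blast
    qed
    then have "generated_field (insert y (range \<iota>)) \<subseteq> generated_field (insert \<eta> (range \<iota>))"
      unfolding generated_field_def by blast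
    then show ?thesis using generated by blast
  qed
  interpret radical_function_field \<iota> m g \<eta>
    by standard (use m_ge_2 eta generator in auto)
  obtain R where valuation_ring: "valuation_ring constants R" and Q: "Q = R - ring_units R"
    using assms(6) unfolding is_place_def by blast
  obtain v where v: "v \<in> base_valuations" "lies_over R v"
    using lies_over_base_valuation[OF valuation_ring] by blast
  \<comment> \<open>Otherwise some h has a zero at s and a pole at v; the former puts \<iota> h into
    Q, the latter keeps it out of R.\<close>
  have "v = index_valuation p s"
  proof (rule ccontr)
    assume "v \<noteq> index_valuation p s"
    then obtain h where h: "h \<noteq> 0" "index_valuation p s h > 0" "v h < 0"
      using base_valuations_separated[OF index_valuation_base[OF assms(2)] v(1)] by metis
    have "h \<in> kummer_base_place p s"
    proof (cases "s = 0")
      case False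
      then have "prime_elem (p s)"
        using irreducible assms(2) by (intro field_poly_irreducible_imp_prime) auto
      then show ?thesis
        using False h vfin_pos_imp_zero_place by (simp add: kummer_base_place_def index_valuation_def)
    qed (use h vinf_pos_imp_infinite_place in \<open>simp add: kummer_base_place_def index_valuation_def\<close>)
    then have "\<iota> h \<in> R" using assms(7) Q by blast
    then show False using v(2) h by (simp add: lies_over_def)
  qed
  note over = v(2)[unfolded this]
  have val_g: "w g = - \<mu> * w (prime_product l)" if w: "w \<in> base_valuations" for w
  proof -
    interpret w: discrete_valuation w by (rule discrete_valuation_base[OF w])
    show ?thesis
      using f const_nonzero prime_product_nonzero base_valuation_const[OF w alpha_nonzero]
      by (simp add: g_def w.val_power_int) (simp add: f_eq w.val_mult)
  qed
  have V_g: "index_valuation p k g = - \<mu> * kummer_exp r p l k" if k: "k \<le> r" for k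
    unfolding val_g[OF index_valuation_base[OF k]] using k
    by (auto simp: index_valuation_def kummer_exp_def vinf_prime_product vfin_prime_product)
  \<comment> \<open>The finite subfield makes q vanish in K and, through the embedding, in F. So the
    characteristic of F is a prime divisor of q and is prime to m.\<close>
  have "of_nat q = (0 :: 'k)"
  proof -
    obtain k :: "'k set" where "is_subfield k" "card k = q" using K_algebraic by blast
    moreover have "finite k"
      using \<open>card k = q\<close> q_primepow by (metis card.infinite primepow_gt_0_nat less_irrefl)
    ultimately show ?thesis using of_nat_card_subfield by blast
  qed
  moreover have "of_nat n = \<iota> (const_fract (of_nat n))" for n
  proof (induction n)
    case (Suc n)
    have "const_fract (of_nat (Suc n)) = to_fract (1 + [:of_nat n :: 'k:])"
      by (simp add: const_fract_def one_pCons)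
    also have "\<dots> = 1 + const_fract (of_nat n)"
      by (simp only: to_fract_add to_fract_1 const_fract_def)
    finally show ?case using Suc by (simp add: hom_add)
  qed (simp add: const_fract_def)
  ultimately have "of_nat q = (0 :: 'f)" by (simp add: const_fract_def)
  then have char_dvd: "CHAR('f) dvd q" by (simp add: of_nat_eq_0_iff_char_dvd)
  then have "CHAR('f) > 0" using q_primepow by (metis dvd_0_left_iff neq0_conv primepow_gt_0_nat)
  then have char: "prime CHAR('f)" by (rule prime_CHAR_semidom)
  have coprime: "coprime CHAR('f) m"
    using coprime_m_q char_dvd by (metis coprime_commute coprime_divisors dvd_refl)
  interpret ramified_radical_extension \<iota> m g \<eta> r p s R
  proof
    show "[index_valuation p s g = - 1] (mod int m)"
      unfolding V_g[OF assms(2)] using assms(5) by (simp add: cong_minus_minus_iff)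
    fix w assume w: "w \<in> base_valuations" "w \<notin> index_valuation p ` {0..r}"
    from w(1) show "w g = 0"
    proof (cases rule: base_valuation_cases)
      case (1 k)
      then show ?thesis using w(2) by auto
    next
      case (2 q)
      then show ?thesis using val_g[OF w(1)] vfin_prime_product_other by simp
    qed
  qed (use assms valuation_ring over g char coprime in auto)
  have "generator i = int m * ((\<Sum>k=0..r. \<lceil>real_of_int (int i * \<mu> * kummer_exp r p l k) / real m\<rceil>
      * int (kummer_deg p k)) - 1) + int i" for i
    unfolding generator_def ceiling_bound_def by (simp add: V_g mult.assoc)
  then show ?thesis
    using pole_numbers_eq unfolding pole_numbers_def Q by simp
qed

end
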